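(* Assume (A1). Then for every $\delta>0$ there exists $\sigma>0$, independent of $\varepsilon$, such that $$|R(\lambda,\varepsilon)|=\mathcal O\big(e^{-\sigma/\varepsilon}\big)\qquad(\varepsilon\to0^+),$$ uniformly for $\lambda\in(-\infty,-\delta]\cup[\delta,\infty)$.
   Context: Let $\varepsilon>0$ be a small (semiclassical) parameter. For $\rho,\theta>0$ set $D(\rho,\theta)=\{x\in\mathbb C:\ |\mathrm{Im}\,x|<\max(\rho,(\tan\theta)|\mathrm{Re}\,x|)\}$. Assumption (A1): $A:\mathbb R\to\mathbb R$ is positive and smooth, extends holomorphically to $D_0=D(\rho_0,\theta_0)$ for some $\rho_0,\theta_0>0$, and there is $\tau>0$ with $A(x)=\mathcal O(|x|^{-1-\tau})$ as $|x|\to\infty$ in $D_0$. Consider the non-self-adjoint Dirac (Zakharov–Shabat) operator $L=\begin{pmatrix}-\frac{\varepsilon}{i}\frac{d}{dx} & -iA(x)\\ -iA(x) & \frac{\varepsilon}{i}\frac{d}{dx}\end{pmatrix}$ on $\mathbb C^2$-valued functions on $\mathbb R$. The equation $Lu=\lambda u$ is equivalent to $\frac{\varepsilon}{i}u'=M(x,\lambda)u$ with $M(x,\lambda)=\begin{pmatrix}-\lambda & -iA(x)\\ iA(x)&\lambda\end{pmatrix}$. Reflection coefficient: for real $\lambda\neq0$, the Jost solutions are the unique solutions with $f^r_+\sim(0,e^{i\lambda x/\varepsilon})^T$, $f^r_-\sim(e^{-i\lambda x/\varepsilon},0)^T$ as $x\to+\infty$, and $f^l_+\sim(0,e^{i\lambda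 x/\varepsilon})^T$, $f^l_-\sim(e^{-i\lambda x/\varepsilon},0)^T$ as $x\to-\infty$. Writing $(f^l_+,f^l_-)=(f^r_+,f^r_-)\begin{pmatrix}a & \bar b\\ b&\bar a\end{pmatrix}$, the reflection coefficient is $R(\lambda,\varepsilon)=b(\lambda,\varepsilon)/a(\lambda,\varepsilon)$. *)

theory Defs
  imports "HOL-Analysis.Analysis"
begin

definition Dom :: "real \<Rightarrow> real \<Rightarrow> complex set" where
  "Dom \<rho> \<theta> = {x. \<bar>Im x\<bar> < max \<rho> (tan \<theta> * \<bar>Re x\<bar>)}"

definition smooth_real :: "(real \<Rightarrow> real) \<Rightarrow> bool" where
  "smooth_real A \<longleftrightarrow> (\<forall>n x. (deriv ^^ n) A differentiable (at x))"

definition assumption_A1 :: "(real \<Rightarrow> real) \<Rightarrow> bool" where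
  "assumption_A1 A \<longleftrightarrow>
     (\<forall>x. A x > 0) \<and> smooth_real A \<and>
     (\<exists>\<rho>0 \<theta>0 F. \<rho>0 > 0 \<and> \<theta>0 > 0 \<and> \<theta>0 < pi / 2 \<and>
        F holomorphic_on Dom \<rho>0 \<theta>0 \<and>
        (\<forall>x::real. F (complex_of_real x) = complex_of_real (A x)) \<and>
        (\<exists>\<tau> > 0. \<exists>C R. \<forall>z \<in> Dom \<rho>0 \<theta>0.
            norm z \<ge> R \<longrightarrow> norm (F z) \<le> C * norm z powr (-1 - \<tau>)))"

(* u = (u1,u2) solves (eps/i) u' = M(x,lambda) u,
   M = [[-lambda, -i A],[i A, lambda]], i.e. u' = (i/eps) M u *)
definition ZS_solution ::
  "(real \<Rightarrow> real) \<Rightarrow> real \<Rightarrow> real \<Rightarrow> (real \<Rightarrow> complex) \<Rightarrow> (real \<Rightarrow> complex) \<Rightarrow> bool" where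
  "ZS_solution A \<epsilon> lam u1 u2 \<longleftrightarrow>
     (\<forall>x. (u1 has_vector_derivative
             (\<i> / complex_of_real \<epsilon>) * (- complex_of_real lam * u1 x - \<i> * complex_of_real (A x) * u2 x)) (at x)
        \<and> (u2 has_vector_derivative
             (\<i> / complex_of_real \<epsilon>) * (\<i> * complex_of_real (A x) * u1 x + complex_of_real lam * u2 x)) (at x))"

definition jost_plus ::
  "(real \<Rightarrow> real) \<Rightarrow> real \<Rightarrow> real \<Rightarrow> real filter \<Rightarrow> (real \<Rightarrow> complex) \<Rightarrow> (real \<Rightarrow> complex) \<Rightarrow> bool" where
  "jost_plus A \<epsilon> lam F u1 u2 \<longleftrightarrow> ZS_solution A \<epsilon> lam u1 u2 \<and>
     (u1 \<longlongrightarrow> 0) F \<and>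
     ((\<lambda>x. u2 x - exp (\<i> * complex_of_real (lam * x / \<epsilon>))) \<longlongrightarrow> 0) F"

definition jost_minus ::
  "(real \<Rightarrow> real) \<Rightarrow> real \<Rightarrow> real \<Rightarrow> real filter \<Rightarrow> (real \<Rightarrow> complex) \<Rightarrow> (real \<Rightarrow> complex) \<Rightarrow> bool" where
  "jost_minus A \<epsilon> lam F u1 u2 \<longleftrightarrow> ZS_solution A \<epsilon> lam u1 u2 \<and>
     ((\<lambda>x. u1 x - exp (- \<i> * complex_of_real (lam * x / \<epsilon>))) \<longlongrightarrow> 0) F \<and>
     (u2 \<longlongrightarrow> 0) F"

(* a, b are the scattering coefficients: f^l_+ = a f^r_+ + b f^r_-
   (first column of (f^l_+, f^l_-) = (f^r_+, f^r_-) [[a, conj b],[b, conj a]]) *)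
definition scattering_ab :: "(real \<Rightarrow> real) \<Rightarrow> real \<Rightarrow> real \<Rightarrow> complex \<Rightarrow> complex \<Rightarrow> bool" where
  "scattering_ab A \<epsilon> lam a b \<longleftrightarrow>
     (\<exists>rp1 rp2 rm1 rm2 lp1 lp2.
        jost_plus A \<epsilon> lam at_top rp1 rp2 \<and> jost_minus A \<epsilon> lam at_top rm1 rm2 \<and>
        jost_plus A \<epsilon> lam at_bot lp1 lp2 \<and>
        (\<forall>x. lp1 x = a * rp1 x + b * rm1 x \<and> lp2 x = a * rp2 x + b * rm2 x))"

end

theory Submission
  imports Defs "HOL-Complex_Analysis.Complex_Analysis"
begin

text \<open>
  Since \<open>A\<close> is real, the system conserves \<open>|u|\<^sup>2\<close>, hence \<open>|a|\<^sup>2 + |b|\<^sup>2 = 1\<close> and it suffices to show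
  that \<open>b\<close> is exponentially small. Continue the solution \<open>f\<^sup>l\<^sub>+\<close> holomorphically to a strip and follow it
  along the curve \<open>\<gamma>(t) = t + \<i> sgn(\<lambda>) \<eta> / p(t)\<close> with \<open>p = \<surd>(\<lambda>\<^sup>2 + A\<^sup>2)\<close>, on which the imaginary part
  of the phase integral of \<open>p\<close> is constant up to \<open>O(\<eta>\<^sup>2)\<close>. With \<open>P = M / p\<close>, which satisfies
  \<open>P\<^sup>2 = 1\<close>, the energy \<open>|u|\<^sup>2 + |P u|\<^sup>2\<close> grows along \<open>\<gamma>\<close> by a factor at most
  \<open>exp (O(1) + O(\<eta>\<^sup>2 / \<epsilon>))\<close>. On the other hand \<open>|u|\<close> tends to \<open>e\<^bsup>-\<eta>/\<epsilon>\<^esup>\<close> at \<open>-\<infinity>\<close> on \<open>\<gamma>\<close> and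
  \<open>|u\<^sub>1|\<close> tends to \<open>|b| e\<^bsup>\<eta>/\<epsilon>\<^esup>\<close> at \<open>+\<infinity>\<close>. So \<open>|b| = O(e\<^bsup>-\<eta>/\<epsilon>\<^esup>)\<close> once \<open>\<eta>\<close> is small; all constants
  depend on \<open>\<lambda>\<close> only through the lower bound \<open>\<delta>\<close>.
\<close>

section \<open>Strips and decay weights\<close>

definition strip :: "real \<Rightarrow> complex set" where
  "strip r = {z. \<bar>Im z\<bar> < r}"

text \<open>The exponent makes the weight integrable, with total mass 2/\<tau> over the line; the 1
  removes the singularity at 0 and gives the bound \<open>wt_le_1\<close>. Bounds in a strip are
  stated with the weight at the real part, so they survive vertical displacement.\<close>

definition wt :: "real \<Rightarrow> real \<Rightarrow> real" where
  "wt \<tau> t = (1 + \<bar>t\<bar>) powr (-1 - \<tau>)"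

lemma open_strip: "open (strip r)"
  unfolding strip_def by (intro open_Collect_less continuous_intros)

lemma convex_strip: "convex (strip r)"
proof -
  have "strip r = {z. Im z < r} \<inter> {z. Im z > - r}"
    by (auto simp: strip_def)
  then show ?thesis
    by (simp add: convex_Int convex_halfspace_Im_lt convex_halfspace_Im_gt)
qed

lemma strip_mono: "r \<le> s \<Longrightarrow> z \<in> strip r \<Longrightarrow> z \<in> strip s"
  by (auto simp: strip_def)

lemma wt_pos: "wt \<tau> t > 0"
  by (simp add: wt_def add_pos_nonneg)

lemma wt_nonneg: "wt \<tau> t \<ge> 0"
  using wt_pos[of \<tau> t] by simp

lemma wt_le_1: "\<tau> > 0 \<Longrightarrow> wt \<tau> t \<le> 1"
  unfolding wt_def using powr_mono2'[of "-1-\<tau>" 1 "1+\<bar>t\<bar>"] by simp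

lemma wt_half: "((1 + \<bar>t\<bar>)/2) powr (-1-\<tau>) = 2 powr (1+\<tau>) * wt \<tau> t"
  using powr_minus_divide[of 2 "1+\<tau>"] by (simp add: wt_def powr_divide)

text \<open>For |s - t| <= 1 one has 1 + |s| >= (1 + |t|)/2, and the power is decreasing.\<close>

lemma wt_shift:
  assumes "\<tau> > 0" "\<bar>s - t\<bar> \<le> 1"
  shows "wt \<tau> s \<le> 2 powr (1+\<tau>) * wt \<tau> t"
proof -
  have "(1 + \<bar>s\<bar>) powr (-1-\<tau>) \<le> ((1 + \<bar>t\<bar>)/2) powr (-1-\<tau>)"
    using assms by (intro powr_mono2') auto
  also have "\<dots> = 2 powr (1+\<tau>) * wt \<tau> t"
    by (rule wt_half)
  finally show ?thesis by (simp add: wt_def)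
qed

lemma wt_tendsto_0:
  assumes "\<tau> > 0"
  shows "(wt \<tau> \<longlongrightarrow> 0) at_top" "(wt \<tau> \<longlongrightarrow> 0) at_bot"
proof -
  have "filterlim (abs :: real \<Rightarrow> real) at_top at_bot"
    using filterlim_abs_real by (simp add: filterlim_at_bot_mirror)
  then show "(wt \<tau> \<longlongrightarrow> 0) at_bot"
    unfolding wt_def[abs_def] using assms
    by (auto intro!: tendsto_neg_powr filterlim_tendsto_add_at_top[OF tendsto_const])
  show "(wt \<tau> \<longlongrightarrow> 0) at_top"
    unfolding wt_def[abs_def] using assms filterlim_abs_real
    by (auto intro!: tendsto_neg_powr filterlim_tendsto_add_at_top[OF tendsto_const])
qed

text \<open>Cauchy's inequality on the circle of radius \<open>d\<close>, where
  \<open>wt_shift\<close> costs the factor \<open>2 powr (1+\<tau>)\<close>. Subtracting the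
  constant \<open>k\<close> does not change the derivative and admits functions with a nonzero limit
  at infinity, such as the momentum.\<close>

lemma Cauchy_decay:
  assumes g: "g holomorphic_on strip r" and \<tau>: "\<tau> > 0" and d: "0 < d" "d \<le> 1"
    and bd: "\<And>z. z \<in> strip r \<Longrightarrow> norm (g z - k) \<le> B * wt \<tau> (Re z)"
    and z: "z \<in> strip (r - d)"
  shows "norm (deriv g z) \<le> 2 powr (1+\<tau>) * B / d * wt \<tau> (Re z)"
proof -
  have sub: "cball z d \<subseteq> strip r"
  proof
    fix w assume "w \<in> cball z d"
    then have "\<bar>Im z - Im w\<bar> \<le> d"
      using abs_Im_le_cmod[of "z - w"] by (simp add: dist_norm)
    then show "w \<in> strip r" using z by (auto simp: strip_def)
  qed
  have B: "B \<ge> 0"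
  proof -
    have "z \<in> strip r" using sub d by auto
    then have "0 \<le> B * wt \<tau> (Re z)" using bd norm_ge_zero order_trans by blast
    then show ?thesis using wt_pos[of \<tau> "Re z"] by (simp add: zero_le_mult_iff)
  qed
  have hol: "(\<lambda>z. g z - k) holomorphic_on cball z d"
    using holomorphic_on_subset[OF g sub] by (intro holomorphic_intros)
  have "norm ((deriv ^^ 1) (\<lambda>z. g z - k) z) \<le> fact 1 * (B * (2 powr (1+\<tau>) * wt \<tau> (Re z))) / d ^ 1"
  proof (rule Cauchy_inequality)
    show "(\<lambda>z. g z - k) holomorphic_on ball z d"
      using hol ball_subset_cball holomorphic_on_subset by blast
    show "continuous_on (cball z d) (\<lambda>z. g z - k)"
      using hol holomorphic_on_imp_continuous_on by blast
    fix w assume w: "cmod (z - w) = d"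
    then have "w \<in> strip r" using sub by (auto simp: dist_norm)
    then have "norm (g w - k) \<le> B * wt \<tau> (Re w)" by (rule bd)
    also have "\<dots> \<le> B * (2 powr (1+\<tau>) * wt \<tau> (Re z))"
      using abs_Re_le_cmod[of "w - z"] w d B \<tau>
      by (intro mult_left_mono wt_shift) (auto simp: norm_minus_commute)
    finally show "norm (g w - k) \<le> \<dots>" .
  qed (use d in auto)
  moreover have "deriv (\<lambda>z. g z - k) z = deriv g z"
  proof -
    have "g field_differentiable at z"
      using g sub d open_strip by (intro holomorphic_on_imp_differentiable_at[of g "strip r"]) auto
    then show ?thesis by (subst deriv_diff) auto
  qed
  ultimately show ?thesis by (simp add: mult_ac)
qed

section \<open>Gronwall inequalities, with the rate given through a primitive\<close>

lemma gronwall: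
  fixes E E' K k :: "real \<Rightarrow> real"
  assumes ab: "a \<le> b"
    and E: "\<And>t. a \<le> t \<Longrightarrow> t \<le> b \<Longrightarrow> (E has_real_derivative E' t) (at t)"
    and K: "\<And>t. a \<le> t \<Longrightarrow> t \<le> b \<Longrightarrow> (K has_real_derivative k t) (at t)"
    and le: "\<And>t. a \<le> t \<Longrightarrow> t \<le> b \<Longrightarrow> E' t \<le> k t * E t"
  shows "E b \<le> E a * exp (K b - K a)"
proof -
  have "E b * exp (- K b) \<le> E a * exp (- K a)"
  proof (rule DERIV_nonpos_imp_nonincreasing[OF ab])
    fix t assume t: "a \<le> t" "t \<le> b"
    have "((\<lambda>t. E t * exp (- K t)) has_real_derivative
        (E' t - k t * E t) * exp (- K t)) (at t)"
      by (rule derivative_eq_intros E[OF t] K[OF t] refl)+ (simp add: algebra_simps)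
    then show "\<exists>y. ((\<lambda>t. E t * exp (- K t)) has_real_derivative y) (at t) \<and> y \<le> 0"
      using le[OF t] by (auto intro!: exI mult_nonpos_nonneg)
  qed
  then have "E b * exp (- K b) * exp (K b) \<le> E a * exp (- K a) * exp (K b)"
    by (rule mult_right_mono) simp
  then show ?thesis by (simp add: mult.assoc exp_add[symmetric] exp_minus_inverse)
qed

text \<open>The weight has mass 1/\<tau> on each half-line, so the growth factor depends on neither
  \<open>x\<close> nor \<open>y\<close>, which can later be sent to the two infinities. The split at
  0 gives an elementary primitive on each side.\<close>

lemma gronwall_wt:
  fixes E E' :: "real \<Rightarrow> real"
  assumes \<tau>: "\<tau> > 0" and c: "c \<ge> 0" and xy: "x \<le> 0" "0 \<le> y"
    and E: "\<And>t. (E has_real_derivative E' t) (at t)"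
    and le: "\<And>t. E' t \<le> c * wt \<tau> t * E t" and pos: "\<And>t. E t \<ge> 0"
  shows "E y \<le> E x * exp (2 * c / \<tau>)"
proof -
  have *: "((\<lambda>t. - c * (1 + t) powr (- \<tau>) / \<tau>) has_real_derivative c * wt \<tau> t) (at t)"
    if "t \<ge> 0" for t
    using DERIV_cmult[OF DERIV_fun_powr[of "\<lambda>t. 1 + t" 1 t "-\<tau>"], of "- c / \<tau>"] that \<tau>
    by (auto simp: wt_def minus_diff_commute intro!: derivative_eq_intros)
  have **: "((\<lambda>t. c * (1 - t) powr (- \<tau>) / \<tau>) has_real_derivative c * wt \<tau> t) (at t)"
    if "t \<le> 0" for t
    using DERIV_cmult[OF DERIV_fun_powr[of "\<lambda>t. 1 - t" "-1" t "-\<tau>"], of "c / \<tau>"] that \<tau>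
    by (auto simp: wt_def minus_diff_commute intro!: derivative_eq_intros)
  have "E y \<le> E 0 * exp (- c * (1 + y) powr (- \<tau>) / \<tau> - (- c * (1 + 0) powr (- \<tau>) / \<tau>))"
    by (rule gronwall[OF xy(2) E *]) (auto intro: le)
  also have "\<dots> \<le> E 0 * exp (c / \<tau>)"
    using \<tau> c xy by (intro mult_left_mono pos) auto
  finally have 1: "E y \<le> E 0 * exp (c / \<tau>)" .
  have "E 0 \<le> E x * exp (c * (1 - 0) powr (- \<tau>) / \<tau> - c * (1 - x) powr (- \<tau>) / \<tau>)"
    by (rule gronwall[OF xy(1) E **]) (auto intro: le)
  also have "\<dots> \<le> E x * exp (c / \<tau>)"
    using \<tau> c xy by (intro mult_left_mono pos) auto
  finally have 2: "E 0 \<le> E x * exp (c / \<tau>)" .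
  have "E y \<le> E x * exp (c / \<tau>) * exp (c / \<tau>)"
    using order_trans[OF 1 mult_right_mono[OF 2, of "exp (c / \<tau>)"]] by simp
  then show ?thesis by (simp add: mult.assoc exp_add[symmetric] algebra_simps)
qed

text \<open>Far out the decay hypothesis applies; the rest of the strip of half the width lies in a
  compact subset of the domain, where \<open>F\<close> is bounded by continuity. \<open>C'\<close>
  adds the two resulting constants.\<close>

lemma assumption_A1_strip:
  assumes "assumption_A1 A"
  obtains F r \<tau> C where "r > 0" "\<tau> > 0" "C \<ge> 0" "F holomorphic_on strip r"
    "\<And>x::real. F (of_real x) = of_real (A x)"
    "\<And>z. z \<in> strip r \<Longrightarrow> norm (F z) \<le> C * wt \<tau> (Re z)"
proof -
  from assms obtain \<rho> \<theta> F \<tau> C R where \<rho>: "\<rho> > 0" and hol: "F holomorphic_on Dom \<rho> \<theta>"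
    and FA: "\<And>x::real. F (of_real x) = of_real (A x)" and \<tau>: "\<tau> > 0"
    and bd: "\<And>z. z \<in> Dom \<rho> \<theta> \<Longrightarrow> norm z \<ge> R \<Longrightarrow> norm (F z) \<le> C * norm z powr (-1 - \<tau>)"
    unfolding assumption_A1_def by blast
  \<comment> \<open>The lower bound 1 ensures |z| >= (1 + |Re z|)/2 outside the disc, so the power
    of |z| there is comparable with the weight.\<close>
  define R' where "R' = max R 1"
  define K where "K = {z. \<bar>Im z\<bar> \<le> \<rho>/2} \<inter> cball 0 R'"
  have sub: "{z. \<bar>Im z\<bar> \<le> \<rho>/2} \<subseteq> Dom \<rho> \<theta>"
    using \<rho> by (auto simp: Dom_def)
  have "compact K"
    unfolding K_def by (intro closed_Int_compact closed_Collect_le continuous_intros compact_cball)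
  moreover have "continuous_on K F"
    using sub by (intro holomorphic_on_imp_continuous_on holomorphic_on_subset[OF hol]) (auto simp: K_def)
  ultimately have "bounded (F ` K)"
    using compact_continuous_image compact_imp_bounded by blast
  then obtain B where B: "B > 0" "\<And>z. z \<in> K \<Longrightarrow> norm (F z) \<le> B"
    by (auto simp: bounded_pos)
  define C' where "C' = \<bar>C\<bar> * 2 powr (1+\<tau>) + B * (1 + R') powr (1+\<tau>)"
  have bound: "norm (F z) \<le> C' * wt \<tau> (Re z)" if z: "z \<in> strip (\<rho>/2)" for z
  proof (cases "norm z \<le> R'")
    case True
    then have "norm (F z) \<le> B" using z by (intro B) (auto simp: K_def strip_def)
    also have "\<dots> = B * (1 + R') powr (1+\<tau>) * (1 + R') powr (-1-\<tau>)"
      by (simp add: powr_add[symmetric] R'_def)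
    also have "\<dots> \<le> B * (1 + R') powr (1+\<tau>) * wt \<tau> (Re z)"
      unfolding wt_def using True abs_Re_le_cmod[of z] B \<tau>
      by (intro mult_left_mono powr_mono2') auto
    also have "\<dots> \<le> C' * wt \<tau> (Re z)"
      by (intro mult_right_mono wt_nonneg) (simp add: C'_def)
    finally show ?thesis .
  next
    case False
    then have z': "norm z \<ge> R" "norm z \<ge> 1" by (auto simp: R'_def)
    have "norm (F z) \<le> C * norm z powr (-1 - \<tau>)"
      using z z' sub by (intro bd) (auto simp: strip_def)
    also have "\<dots> \<le> \<bar>C\<bar> * norm z powr (-1 - \<tau>)"
      by (intro mult_right_mono) auto
    also have "norm z powr (-1 - \<tau>) \<le> ((1 + \<bar>Re z\<bar>)/2) powr (-1-\<tau>)"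
      using z' abs_Re_le_cmod[of z] \<tau> by (intro powr_mono2') auto
    also have "\<dots> = 2 powr (1+\<tau>) * wt \<tau> (Re z)"
      by (rule wt_half)
    finally have "norm (F z) \<le> \<bar>C\<bar> * 2 powr (1+\<tau>) * wt \<tau> (Re z)"
      by (simp add: mult_left_mono mult.assoc)
    also have "\<dots> \<le> C' * wt \<tau> (Re z)"
      using B by (intro mult_right_mono wt_nonneg) (simp add: C'_def)
    finally show ?thesis .
  qed
  have "F holomorphic_on strip (\<rho>/2)"
    using sub by (intro holomorphic_on_subset[OF hol]) (auto simp: strip_def)
  then show thesis
    using that[of "\<rho>/2" \<tau> C' F] \<rho> \<tau> B FA bound by (auto simp: C'_def)
qed

section \<open>Holomorphic linear systems\<close>

text \<open>Integration along the segment from 0 to \<open>z\<close> turns one term of the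
  exponential series into the next. This is the induction step for the Picard iterates
  below.\<close>

lemma norm_primitive_le_power:
  fixes f :: "complex \<Rightarrow> complex"
  assumes S: "convex S" "0 \<in> S" "z \<in> S"
    and f: "\<And>z. z \<in> S \<Longrightarrow> (f has_field_derivative f' z) (at z)" and f0: "f 0 = 0"
    and bd: "\<And>z. z \<in> S \<Longrightarrow> norm (f' z) \<le> K * (M * (K * norm z) ^ n / fact n)"
  shows "norm (f z) \<le> M * (K * norm z) ^ Suc n / fact (Suc n)"
proof -
  define \<phi> where "\<phi> = (\<lambda>t. M * (K * norm z * t) ^ Suc n / fact (Suc n))"
  have seg: "of_real t * z \<in> S" if "0 \<le> t" "t \<le> 1" for t :: real
    using convexD[OF S(1,2,3), of "1 - t" t] that by (simp add: scaleR_conv_of_real)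
  have f1: "((\<lambda>t. f (of_real t * z)) has_vector_derivative z * f' (of_real t * z)) (at t)"
    if "0 \<le> t" "t \<le> 1" for t :: real
  proof -
    have "((\<lambda>t. of_real t * z) has_vector_derivative z) (at t)"
      by (auto intro!: derivative_eq_intros simp: has_vector_derivative_def scaleR_conv_of_real)
    from field_vector_diff_chain_at[OF this f[OF seg[OF that]]] show ?thesis
      by (simp add: o_def)
  qed
  have p1: "(\<phi> has_real_derivative norm z * (K * (M * (K * norm z * t) ^ n / fact n))) (at t)" for t
  proof -
    have "(\<phi> has_real_derivative
        M * (real (Suc n) * (K * norm z * t) ^ n * (K * norm z)) / fact (Suc n)) (at t)"
      unfolding \<phi>_def
      using DERIV_power[OF DERIV_cmult_Id[of "K * norm z" t], of "Suc n"]
      by (intro DERIV_cdivide DERIV_cmult) (simp add: mult_ac)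
    moreover have "M * (real (Suc n) * (K * norm z * t) ^ n * (K * norm z)) / fact (Suc n) =
        norm z * (K * (M * (K * norm z * t) ^ n / fact n))"
      by (simp add: mult_ac del: of_nat_Suc)
    ultimately show ?thesis by (simp only:)
  qed
  have "norm (f (of_real 1 * z) - f (of_real 0 * z)) \<le> \<phi> 1 - \<phi> 0"
  proof (rule differentiable_bound_general)
    show "continuous_on {0..1} (\<lambda>t. f (of_real t * z))"
      by (intro continuous_at_imp_continuous_on) (auto intro!: has_vector_derivative_continuous[OF f1])
    show "continuous_on {0..1} \<phi>"
      using p1 by (intro continuous_at_imp_continuous_on) (auto intro: DERIV_isCont)
    fix t :: real assume t: "0 < t" "t < 1"
    show "((\<lambda>t. f (of_real t * z)) has_vector_derivative z * f' (of_real t * z)) (at t)"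
      using f1 t by simp
    show "(\<phi> has_vector_derivative norm z * (K * (M * (K * norm z * t) ^ n / fact n))) (at t)"
      using p1 by (simp add: has_real_derivative_iff_has_vector_derivative)
    have "norm (f' (of_real t * z)) \<le> K * (M * (K * norm (of_real t * z)) ^ n / fact n)"
      using t by (intro bd seg) auto
    from mult_left_mono[OF this norm_ge_zero[of z]]
    show "norm (z * f' (of_real t * z)) \<le> norm z * (K * (M * (K * norm z * t) ^ n / fact n))"
      using t by (simp add: norm_mult mult_ac)
  qed simp
  then show ?thesis by (simp add: f0 \<phi>_def)
qed

text \<open>Picard iteration with antiderivatives instead of integrals: they exist on a convex open
  set, and the factorial bounds on the iterates make their series converge uniformly on bounded
  parts of \<open>S\<close>. The intended \<open>S\<close> is an unbounded strip.\<close>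

lemma holomorphic_linear_system_exists:
  fixes g k :: "complex \<Rightarrow> complex"
  assumes S: "convex S" "open S" "0 \<in> S"
    and hol: "g holomorphic_on S" "k holomorphic_on S"
    and K: "\<And>z. z \<in> S \<Longrightarrow> norm (g z) \<le> K" "\<And>z. z \<in> S \<Longrightarrow> norm (k z) \<le> K"
  obtains w1 w2 where "w1 0 = \<alpha>" "w2 0 = \<beta>"
    "\<And>z. z \<in> S \<Longrightarrow> (w1 has_field_derivative g z * w2 z) (at z)"
    "\<And>z. z \<in> S \<Longrightarrow> (w2 has_field_derivative k z * w1 z) (at z)"
proof -
  have "\<exists>F. F 0 = 0 \<and> (\<forall>z\<in>S. (F has_field_derivative f z) (at z))"
    if f: "f holomorphic_on S" for f
  proof -
    obtain F where "\<And>z. z \<in> S \<Longrightarrow> (F has_field_derivative f z) (at z within S)"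
      by (rule holomorphic_convex_primitive'[OF S(1,2) f]) (rule that)
    then have F: "(F has_field_derivative f z) (at z)" if "z \<in> S" for z
      using at_within_open[OF that S(2)] that by metis
    have "\<forall>z\<in>S. ((\<lambda>z. F z - F 0) has_field_derivative f z) (at z)"
      using DERIV_diff[OF F DERIV_const] by simp
    then show ?thesis by (intro exI[of _ "\<lambda>z. F z - F 0"]) auto
  qed
  \<comment> \<open>A single operator \<open>I\<close> selects, for every holomorphic function, the
    antiderivative vanishing at 0; the iteration then becomes a plain recursion.\<close>
  then have "\<forall>f. \<exists>F. f holomorphic_on S \<longrightarrow> F 0 = 0 \<and> (\<forall>z\<in>S. (F has_field_derivative f z) (at z))"
    by blast
  from choice[OF this] obtain I where I0: "\<And>f. f holomorphic_on S \<Longrightarrow> I f 0 = 0"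
    and I: "\<And>f z. f holomorphic_on S \<Longrightarrow> z \<in> S \<Longrightarrow> (I f has_field_derivative f z) (at z)"
    by auto
  have Ihol: "I f holomorphic_on S" if "f holomorphic_on S" for f
    using I[OF that] S(2) by (auto simp: holomorphic_on_open)
  define W where "W = rec_nat (\<lambda>z. \<alpha>, \<lambda>z. \<beta>)
    (\<lambda>n p. (I (\<lambda>z. g z * snd p z), I (\<lambda>z. k z * fst p z)))"
  define a where "a = (\<lambda>n. fst (W n))"
  define b where "b = (\<lambda>n. snd (W n))"
  have a0: "a 0 = (\<lambda>z. \<alpha>)" and b0: "b 0 = (\<lambda>z. \<beta>)"
    and aS: "a (Suc n) = I (\<lambda>z. g z * b n z)" and bS: "b (Suc n) = I (\<lambda>z. k z * a n z)" for n
    by (simp_all add: a_def b_def W_def)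
  have ab_hol: "a n holomorphic_on S \<and> b n holomorphic_on S" for n
    by (induction n) (auto simp: a0 b0 aS bS intro!: Ihol holomorphic_intros hol)
  have gb: "(\<lambda>z. g z * b n z) holomorphic_on S" and ka: "(\<lambda>z. k z * a n z) holomorphic_on S" for n
    using ab_hol[of n] by (auto intro!: holomorphic_intros hol)
  define M where "M = norm \<alpha> + norm \<beta>"
  have K0: "K \<ge> 0" using order_trans[OF norm_ge_zero K(1)[OF S(3)]] .
  have bound: "\<forall>z\<in>S. norm (a n z) \<le> M * (K * norm z) ^ n / fact n
      \<and> norm (b n z) \<le> M * (K * norm z) ^ n / fact n" for n
  proof (induction n)
    case 0
    show ?case by (simp add: a0 b0 M_def)
  next
    case (Suc n)
    have "norm (g z * b n z) \<le> K * (M * (K * norm z) ^ n / fact n)"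
      "norm (k z * a n z) \<le> K * (M * (K * norm z) ^ n / fact n)" if "z \<in> S" for z
      unfolding norm_mult using Suc that K K0 by (blast intro: mult_mono norm_ge_zero)+
    then have "norm (I (\<lambda>z. g z * b n z) z) \<le> M * (K * norm z) ^ Suc n / fact (Suc n)"
      "norm (I (\<lambda>z. k z * a n z) z) \<le> M * (K * norm z) ^ Suc n / fact (Suc n)" if "z \<in> S" for z
      using norm_primitive_le_power[OF S(1,3) that I[OF gb] I0[OF gb]]
        norm_primitive_le_power[OF S(1,3) that I[OF ka] I0[OF ka]] that by blast+
    then show ?case
      unfolding aS bS by blast
  qed
  \<comment> \<open>Term-by-term differentiation, for abstract \<open>p\<close>, \<open>q\<close>,
    \<open>h\<close> because the two components enter symmetrically and both are instances.\<close>
  have series: "((\<lambda>z. \<Sum>n. p n z) has_field_derivative h z * (\<Sum>n. q n z)) (at z)"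
    if z: "z \<in> S" and p0: "p 0 = (\<lambda>z. c)" and pS: "\<And>n. p (Suc n) = I (\<lambda>z. h z * q n z)"
      and hq: "\<And>n. (\<lambda>z. h z * q n z) holomorphic_on S"
      and h: "\<And>z. z \<in> S \<Longrightarrow> norm (h z) \<le> K"
      and q: "\<And>n z. z \<in> S \<Longrightarrow> norm (q n z) \<le> M * (K * norm z) ^ n / fact n"
    for p q h and c z :: complex
  proof -
    \<comment> \<open>The majorant \<open>B n\<close> needs a bound on |z|, so the argument is
      confined to a bounded convex piece \<open>T\<close> of \<open>S\<close> around
      \<open>z\<close>.\<close>
    define N where "N = norm z + 1"
    define T where "T = S \<inter> ball 0 N"
    \<comment> \<open>The term \<open>p 0\<close> is constant, so the differentiated series starts
      with 0 and is shifted by one against \<open>q\<close>.\<close>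
    define p' where "p' = (\<lambda>n z. case n of 0 \<Rightarrow> 0 | Suc m \<Rightarrow> h z * q m z)"
    define B where "B = (\<lambda>n. M * (K * N) ^ n / fact n)"
    have N: "N > 0" by (simp add: N_def add_nonneg_pos)
    have M: "M \<ge> 0" by (simp add: M_def)
    have B: "summable B"
      unfolding B_def using summable_mult[OF summable_exp[of "K * N"], of M] by (simp add: field_simps)
    have qB: "norm (q n x) \<le> B n" if "x \<in> T" for n x
    proof -
      have "norm (q n x) \<le> M * (K * norm x) ^ n / fact n" using q that by (simp add: T_def)
      also have "\<dots> \<le> B n" unfolding B_def
        using that M K0 N by (intro divide_right_mono mult_left_mono power_mono) (auto simp: T_def)
      finally show ?thesis .
    qed
    have T: "convex T" "0 \<in> T" "interior T = T" "z \<in> T"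
      using S z N by (auto simp: T_def N_def convex_Int interior_open)
    have "uniformly_convergent_on T (\<lambda>n x. \<Sum>i<n. p' i x)"
    proof (rule Weierstrass_m_test')
      show "summable (\<lambda>n. case n of 0 \<Rightarrow> 0 | Suc m \<Rightarrow> K * B m)"
        using summable_mult[OF B, of K] by (subst summable_Suc_iff[symmetric]) simp
      show "norm (p' n x) \<le> (case n of 0 \<Rightarrow> 0 | Suc m \<Rightarrow> K * B m)" if "x \<in> T" for n x
        using qB[OF that] h that K0
        by (auto simp: p'_def T_def norm_mult intro!: mult_mono split: nat.split)
    qed
    moreover have "(p n has_field_derivative p' n x) (at x within T)" if "x \<in> T" for n x
      using that by (cases n) (auto simp: p0 pS p'_def T_def intro!: has_field_derivative_at_within I[OF hq])
    moreover have "summable (\<lambda>n. p n 0)"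
      by (subst summable_Suc_iff[symmetric]) (simp add: pS I0[OF hq])
    ultimately have "((\<lambda>z. \<Sum>n. p n z) has_field_derivative (\<Sum>n. p' n z)) (at z)"
      using T by (intro has_field_derivative_series'(2)[of T p p' 0 z]) auto
    moreover have "(\<Sum>n. p' n z) = h z * (\<Sum>n. q n z)"
    proof -
      have "summable (\<lambda>n. q n z)"
        by (rule summable_comparison_test[OF _ B]) (use qB[OF T(4)] in auto)
      then have "(\<lambda>n. h z * q n z) sums (h z * (\<Sum>n. q n z))"
        by (intro sums_mult summable_sums)
      then have "(\<lambda>n. p' (Suc n) z) sums (h z * (\<Sum>n. q n z))" by (simp add: p'_def)
      from sums_Suc[OF this] show ?thesis by (simp add: p'_def sums_iff)
    qed
    ultimately show ?thesis by simp
  qed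
  show thesis
  proof (rule that[of "\<lambda>z. \<Sum>n. a n z" "\<lambda>z. \<Sum>n. b n z"])
    have a00: "(\<lambda>n. a n 0) = (\<lambda>n. if n = 0 then \<alpha> else 0)"
    proof
      fix n show "a n 0 = (if n = 0 then \<alpha> else 0)" by (cases n) (auto simp: a0 aS I0[OF gb])
    qed
    have b00: "(\<lambda>n. b n 0) = (\<lambda>n. if n = 0 then \<beta> else 0)"
    proof
      fix n show "b n 0 = (if n = 0 then \<beta> else 0)" by (cases n) (auto simp: b0 bS I0[OF ka])
    qed
    show "(\<Sum>n. a n 0) = \<alpha>" unfolding a00 using sums_single[of 0 "\<lambda>_. \<alpha>"] by (simp add: sums_iff)
    show "(\<Sum>n. b n 0) = \<beta>" unfolding b00 using sums_single[of 0 "\<lambda>_. \<beta>"] by (simp add: sums_iff)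
    fix z assume z: "z \<in> S"
    show "((\<lambda>z. \<Sum>n. a n z) has_field_derivative g z * (\<Sum>n. b n z)) (at z)"
      using bound by (intro series[OF z a0 aS gb K(1)]) auto
    show "((\<lambda>z. \<Sum>n. b n z) has_field_derivative k z * (\<Sum>n. a n z)) (at z)"
      using bound by (intro series[OF z b0 bS ka K(2)]) auto
  qed
qed

section \<open>The momentum in a strip\<close>

text \<open>The eigenvalues of \<open>M(x, \<lambda>)\<close> are \<open>\<plusminus>p\<close> with \<open>p = momentum F \<bar>\<lambda>\<bar>\<close>.\<close>

definition momentum :: "(complex \<Rightarrow> complex) \<Rightarrow> real \<Rightarrow> complex \<Rightarrow> complex" where
  "momentum F l z = csqrt (of_real (l\<^sup>2) + (F z)\<^sup>2)"

lemma momentum_sq: "(momentum F l z)\<^sup>2 = of_real (l\<^sup>2) + (F z)\<^sup>2"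
  by (simp add: momentum_def)

lemma momentum_of_real:
  assumes "F z = of_real a"
  shows "momentum F l z = of_real (sqrt (l\<^sup>2 + a\<^sup>2))"
proof -
  have "momentum F l z = csqrt (of_real (l\<^sup>2 + a\<^sup>2))"
    by (simp add: momentum_def assms)
  then show ?thesis by (metis of_real_sqrt sum_power2_ge_zero)
qed

locale decaying_potential =
  fixes F :: "complex \<Rightarrow> complex" and A :: "real \<Rightarrow> real" and r \<tau> C :: real
  assumes r: "r > 0" and \<tau>: "\<tau> > 0" and C: "C \<ge> 0"
    and hol: "F holomorphic_on strip r"
    and FA: "\<And>x::real. F (of_real x) = of_real (A x)"
    and bound: "\<And>z. z \<in> strip r \<Longrightarrow> norm (F z) \<le> C * wt \<tau> (Re z)"
begin

lemma bound_C: "z \<in> strip r \<Longrightarrow> norm (F z) \<le> C"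
  using bound[of z] wt_le_1[OF \<tau>, of "Re z"] C mult_left_mono[of "wt \<tau> (Re z)" 1 C] by simp

text \<open>\<open>F\<close> is real on the axis and \<open>deriv F\<close> is bounded, so Im F is
  small in a narrow strip, and Re (F^2) >= - (Im F)^2. This keeps l^2 + F^2 in the right half-plane,
  off the branch cut of \<open>csqrt\<close>, for all l >= \<delta> at once.\<close>

lemma Re_sq_ge:
  assumes "\<delta> > 0"
  obtains r1 where "0 < r1" "r1 \<le> r" "r1 \<le> 1" "\<And>z. z \<in> strip r1 \<Longrightarrow> Re ((F z)\<^sup>2) \<ge> - \<delta>\<^sup>2 / 4"
proof -
  define d where "d = min 1 (r/2)"
  define B where "B = 2 powr (1+\<tau>) * C / d"
  have d: "0 < d" "d \<le> 1" "d < r" using r by (auto simp: d_def)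
  have B: "B \<ge> 0" using C d by (simp add: B_def)
  have dF: "norm (deriv F z) \<le> B" if "z \<in> strip (r - d)" for z
  proof -
    have "norm (deriv F z) \<le> B * wt \<tau> (Re z)"
      unfolding B_def using that d bound by (intro Cauchy_decay[OF hol \<tau>, of d 0]) auto
    then show ?thesis using mult_left_mono[OF wt_le_1[OF \<tau>] B] by (metis mult.right_neutral order_trans)
  qed
  \<comment> \<open>Chosen so that |Im F| <= \<open>B * r1\<close> <= \<delta>/2; the added 1 covers
    the case B = 0.\<close>
  define r1 where "r1 = min d (\<delta> / (2 * (B + 1)))"
  have r1: "0 < r1" "r1 \<le> d" "r1 \<le> r - d" "r1 * (B + 1) \<le> \<delta> / 2"
  proof -
    show "0 < r1" "r1 \<le> d" using d B assms by (auto simp: r1_def)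
    then show "r1 \<le> r - d" by (auto simp: d_def)
    have "r1 \<le> \<delta> / (2 * (B + 1))" by (simp add: r1_def)
    then show "r1 * (B + 1) \<le> \<delta> / 2" using B by (simp add: field_simps)
  qed
  show thesis
  proof (rule that[of r1])
    fix z assume z: "z \<in> strip r1"
    have zs: "z \<in> strip (r - d)" "of_real (Re z) \<in> strip (r - d)"
      using z r1 by (auto simp: strip_def)
    have "norm (F z - F (of_real (Re z))) \<le> B * norm (z - of_real (Re z))"
    proof (rule field_differentiable_bound[OF convex_strip])
      fix w assume w: "w \<in> strip (r - d)"
      then have "w \<in> strip r" using d by (auto simp: strip_def)
      then show "(F has_field_derivative deriv F w) (at w within strip (r - d))"
        by (rule has_field_derivative_at_within[OF holomorphic_derivI[OF hol open_strip]])
      show "norm (deriv F w) \<le> B" using dF w .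
    qed (use zs in auto)
    moreover have "norm (z - of_real (Re z)) = \<bar>Im z\<bar>"
      by (simp add: cmod_def)
    moreover have "\<bar>Im (F z)\<bar> \<le> norm (F z - F (of_real (Re z)))"
      using abs_Im_le_cmod[of "F z - F (of_real (Re z))"] by (simp add: FA)
    moreover have "B * \<bar>Im z\<bar> \<le> (B + 1) * r1"
      using z B by (intro mult_mono) (auto simp: strip_def)
    ultimately have "\<bar>Im (F z)\<bar> \<le> \<delta> / 2" using r1 by (simp add: mult.commute)
    then have "(Im (F z))\<^sup>2 \<le> (\<delta>/2)\<^sup>2"
      using power_mono[of "\<bar>Im (F z)\<bar>" "\<delta>/2" 2] by simp
    moreover have "Re ((F z)\<^sup>2) = (Re (F z))\<^sup>2 - (Im (F z))\<^sup>2" by (simp add: power2_eq_square)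
    moreover have "(\<delta>/2)\<^sup>2 = \<delta>\<^sup>2 / 4" by (simp add: power_divide)
    ultimately show "Re ((F z)\<^sup>2) \<ge> - \<delta>\<^sup>2 / 4"
      using zero_le_power2[of "Re (F z)"] by linarith
  qed (use r1 d in auto)
qed

text \<open>The point is that \<open>r1\<close> and \<open>B\<close> do not depend on l >= \<delta>.
  From (p - l)(p + l) = F^2 and |p + l| >= l, which holds as the principal root has nonnegative real
  part, the functions p - l, l/p - 1 and F/p are all O(\<open>wt\<close>); Cauchy estimates pass
  this on to the derivatives.\<close>

lemma momentum_bounds:
  assumes \<delta>: "\<delta> > 0"
  obtains r1 B where "0 < r1" "r1 \<le> r" "r1 \<le> 1" "B > 0"
    "\<And>l. l \<ge> \<delta> \<Longrightarrow> momentum F l holomorphic_on strip r1"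
    "\<And>l z. l \<ge> \<delta> \<Longrightarrow> z \<in> strip r1 \<Longrightarrow> norm (momentum F l z) \<ge> l / 2"
    "\<And>l z. l \<ge> \<delta> \<Longrightarrow> z \<in> strip r1 \<Longrightarrow> norm (F z / momentum F l z) \<le> B"
    "\<And>l z. l \<ge> \<delta> \<Longrightarrow> z \<in> strip r1 \<Longrightarrow> norm (deriv (momentum F l) z) \<le> B * wt \<tau> (Re z)"
    "\<And>l z. l \<ge> \<delta> \<Longrightarrow> z \<in> strip r1 \<Longrightarrow> norm (deriv (deriv (momentum F l)) z) \<le> B * wt \<tau> (Re z)"
    "\<And>l z. l \<ge> \<delta> \<Longrightarrow> z \<in> strip r1 \<Longrightarrow> norm (deriv (\<lambda>z. of_real l / momentum F l z) z) \<le> B * wt \<tau> (Re z)"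
    "\<And>l z. l \<ge> \<delta> \<Longrightarrow> z \<in> strip r1 \<Longrightarrow> norm (deriv (\<lambda>z. F z / momentum F l z) z) \<le> B * wt \<tau> (Re z)"
proof -
  obtain r0 where r0: "0 < r0" "r0 \<le> r" "r0 \<le> 1"
    and Re: "\<And>z. z \<in> strip r0 \<Longrightarrow> Re ((F z)\<^sup>2) \<ge> - \<delta>\<^sup>2 / 4"
    using Re_sq_ge[OF \<delta>] by metis
  have hol0: "F holomorphic_on strip r0"
    using r0 strip_mono by (intro holomorphic_on_subset[OF hol]) blast
  have Re_pos: "Re (of_real (l\<^sup>2) + (F z)\<^sup>2) \<ge> (l/2)\<^sup>2" "(l/2)\<^sup>2 > 0"
    if "l \<ge> \<delta>" "z \<in> strip r0" for l z
  proof -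
    have "\<delta>\<^sup>2 \<le> l\<^sup>2" using that \<delta> by (intro power_mono) auto
    moreover have "Re (of_real (l\<^sup>2) + (F z)\<^sup>2) = l\<^sup>2 + Re ((F z)\<^sup>2)" "(l/2)\<^sup>2 = l\<^sup>2 / 4"
      by (simp_all add: power_divide)
    ultimately show "Re (of_real (l\<^sup>2) + (F z)\<^sup>2) \<ge> (l/2)\<^sup>2"
      using Re[OF that(2)] zero_le_power2[of l] by linarith
    show "(l/2)\<^sup>2 > 0" using that \<delta> by simp
  qed
  have hp: "momentum F l holomorphic_on strip r0" if "l \<ge> \<delta>" for l
  proof -
    have "of_real (l\<^sup>2) + (F z)\<^sup>2 \<notin> \<real>\<^sub>\<le>\<^sub>0" if "z \<in> strip r0" for z
      using order_less_le_trans[OF Re_pos(2,1)[OF \<open>l \<ge> \<delta>\<close> that]] unfolding complex_nonpos_Reals_iff by linarith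
    then show ?thesis
      unfolding momentum_def[abs_def] using hol0 by (intro holomorphic_intros) auto
  qed
  have p_ge: "norm (momentum F l z) \<ge> l / 2" if "l \<ge> \<delta>" "z \<in> strip r0" for l z
  proof -
    have "(l/2)\<^sup>2 \<le> norm (of_real (l\<^sup>2) + (F z)\<^sup>2)"
      using Re_pos[OF that] complex_Re_le_cmod order_trans by blast
    also have "\<dots> = (norm (momentum F l z))\<^sup>2"
      by (metis momentum_sq norm_power)
    finally show ?thesis by (rule power2_le_imp_le) simp
  qed
  have p_diff: "norm (momentum F l z - of_real l) \<le> (norm (F z))\<^sup>2 / l" if "l \<ge> \<delta>" "z \<in> strip r0" for l z
  proof -
    have "(momentum F l z - of_real l) * (momentum F l z + of_real l) = (F z)\<^sup>2"
      using momentum_sq[of F l z] by (simp add: algebra_simps power2_eq_square)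
    then have "norm (momentum F l z - of_real l) * norm (momentum F l z + of_real l) = (norm (F z))\<^sup>2"
      by (metis norm_mult norm_power)
    moreover have "l \<le> norm (momentum F l z + of_real l)"
    proof -
      have "Re (momentum F l z) \<ge> 0" unfolding momentum_def using csqrt_principal[of "of_real (l\<^sup>2) + (F z)\<^sup>2"] by linarith
      then have "l \<le> Re (momentum F l z + of_real l)" by simp
      then show ?thesis using complex_Re_le_cmod order_trans by blast
    qed
    ultimately have "norm (momentum F l z - of_real l) * l \<le> (norm (F z))\<^sup>2"
      by (metis mult_left_mono norm_ge_zero)
    then show ?thesis using that \<delta> by (simp add: field_simps)
  qed
  have F2: "(norm (F z))\<^sup>2 \<le> C\<^sup>2 * wt \<tau> (Re z)" if "z \<in> strip r0" for z
  proof -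
    have "z \<in> strip r" using that r0 by (auto simp: strip_def)
    then have "norm (F z) * norm (F z) \<le> C * (C * wt \<tau> (Re z))"
      using C bound bound_C by (intro mult_mono) auto
    then show ?thesis by (simp add: power2_eq_square)
  qed
  \<comment> \<open>The first three terms serve p - l, l/p - 1 and F/p in this order, with
    \<open>l\<close> replaced by its lower bound; the last makes \<open>C1\<close> positive.\<close>
  define C1 where "C1 = C\<^sup>2 / \<delta> + 2 * C\<^sup>2 / \<delta>\<^sup>2 + 2 * C / \<delta> + 1"
  have C1: "C\<^sup>2 / \<delta> \<le> C1" "2 * C\<^sup>2 / \<delta>\<^sup>2 \<le> C1" "2 * C / \<delta> \<le> C1" "C1 > 0"
    using C \<delta> by (auto simp: C1_def add_nonneg_pos)
  have b1: "norm (momentum F l z - of_real l) \<le> C1 * wt \<tau> (Re z)" if lz: "l \<ge> \<delta>" "z \<in> strip r0" for l z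
  proof -
    have "norm (momentum F l z - of_real l) \<le> (norm (F z))\<^sup>2 / l" by (rule p_diff[OF lz])
    also have "\<dots> \<le> (C\<^sup>2 * wt \<tau> (Re z)) / \<delta>"
      using lz \<delta> F2 wt_nonneg by (intro frac_le) auto
    also have "\<dots> = (C\<^sup>2 / \<delta>) * wt \<tau> (Re z)" by simp
    also have "\<dots> \<le> C1 * wt \<tau> (Re z)" by (intro mult_right_mono C1 wt_nonneg)
    finally show ?thesis .
  qed
  have p0: "momentum F l z \<noteq> 0" if lz: "l \<ge> \<delta>" "z \<in> strip r0" for l z
    using p_ge[OF lz] lz \<delta> by auto
  have b2: "norm (of_real l / momentum F l z - 1) \<le> C1 * wt \<tau> (Re z)" if lz: "l \<ge> \<delta>" "z \<in> strip r0" for l z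
  proof -
    have "norm (of_real l / momentum F l z - 1) = norm (momentum F l z - of_real l) / norm (momentum F l z)"
      using p0[OF lz] by (simp add: norm_divide[symmetric] diff_divide_distrib norm_minus_commute)
    also have "\<dots> \<le> ((norm (F z))\<^sup>2 / l) / (l / 2)"
      using lz \<delta> p_ge[OF lz] p_diff[OF lz] by (intro frac_le) auto
    also have "\<dots> = 2 * (norm (F z))\<^sup>2 / l\<^sup>2" by (simp add: power2_eq_square)
    also have "\<dots> \<le> 2 * (C\<^sup>2 * wt \<tau> (Re z)) / \<delta>\<^sup>2"
      using lz \<delta> F2 wt_nonneg by (intro frac_le power_mono) auto
    also have "\<dots> = (2 * C\<^sup>2 / \<delta>\<^sup>2) * wt \<tau> (Re z)" by simp
    also have "\<dots> \<le> C1 * wt \<tau> (Re z)" by (intro mult_right_mono C1 wt_nonneg)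
    finally show ?thesis .
  qed
  have b3: "norm (F z / momentum F l z - 0) \<le> C1 * wt \<tau> (Re z)" if lz: "l \<ge> \<delta>" "z \<in> strip r0" for l z
  proof -
    have "norm (F z / momentum F l z - 0) \<le> (C * wt \<tau> (Re z)) / (\<delta> / 2)"
      unfolding norm_divide diff_zero
      using lz \<delta> p_ge[OF lz] bound[OF strip_mono[OF r0(2) lz(2)]] C wt_nonneg[of \<tau> "Re z"]
      by (intro frac_le mult_nonneg_nonneg) auto
    also have "\<dots> = (2 * C / \<delta>) * wt \<tau> (Re z)" by simp
    also have "\<dots> \<le> C1 * wt \<tau> (Re z)" by (intro mult_right_mono C1 wt_nonneg)
    finally show ?thesis .
  qed
  \<comment> \<open>Every differentiation costs a layer of width \<open>r1\<close> and a factor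
    \<open>G\<close>. The second derivative uses two layers, which leaves a third of the strip and
    explains the two factors \<open>G\<close> in \<open>B\<close>.\<close>
  define r1 where "r1 = r0 / 3"
  define G where "G = 2 powr (1+\<tau>) / r1"
  have r1: "0 < r1" "r1 \<le> 1" "r0 - r1 - r1 = r1" "r0 - r1 \<ge> r1" "r1 \<le> r0" using r0 by (auto simp: r1_def)
  have "2 powr (1 + \<tau>) \<ge> (1::real)" using \<tau> by (intro ge_one_powr_ge_zero) auto
  then have G: "G \<ge> 1" unfolding G_def using r1 by (simp add: le_divide_eq)
  define B where "B = G * (G * C1)"
  have cauchy: "norm (deriv g z) \<le> (G * K) * wt \<tau> (Re z)"
    if "g holomorphic_on strip s" "\<And>z. z \<in> strip s \<Longrightarrow> norm (g z - k) \<le> K * wt \<tau> (Re z)" "z \<in> strip (s - r1)"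
    for g s k K z
    using Cauchy_decay[OF that(1) \<tau> r1(1,2) that(2,3)] by (simp add: G_def)
  have GC: "0 < G * C1" "G * C1 \<le> B" "C1 \<le> B"
  proof -
    have *: "C1 \<le> G * C1" using mult_right_mono[OF G, of C1] C1(4) by simp
    then show "0 < G * C1" using C1(4) by linarith
    then show **: "G * C1 \<le> B" using mult_right_mono[OF G, of "G * C1"] by (simp add: B_def)
    show "C1 \<le> B" using * ** by linarith
  qed
  have up: "x \<le> B * wt \<tau> t" if "x \<le> G * C1 * wt \<tau> t" for x t
    using that mult_right_mono[OF GC(2) wt_nonneg[of \<tau> t]] by linarith
  have B: "B > 0" using GC by linarith
  have in1: "z \<in> strip (r0 - r1)" "z \<in> strip r0" if "z \<in> strip r1" for z
    using that r1 strip_mono by blast+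
  show thesis
  proof (rule that[of r1 B])
    show "momentum F l holomorphic_on strip r1" if "l \<ge> \<delta>" for l
      using in1 by (intro holomorphic_on_subset[OF hp[OF that]]) auto
    fix l z assume l: "l \<ge> \<delta>" and z: "z \<in> strip r1"
    show "norm (momentum F l z) \<ge> l / 2" using p_ge l in1[OF z] by blast
    have "norm (F z / momentum F l z) \<le> C1 * wt \<tau> (Re z)" using b3[OF l in1(2)[OF z]] by simp
    also have "\<dots> \<le> B * 1" using GC C1 wt_le_1[OF \<tau>] B wt_nonneg by (intro mult_mono) auto
    finally show "norm (F z / momentum F l z) \<le> B" by simp
    show "norm (deriv (momentum F l) z) \<le> B * wt \<tau> (Re z)"
      by (rule up) (rule cauchy[OF hp[OF l] b1[OF l] in1(1)[OF z]])
    show "norm (deriv (deriv (momentum F l)) z) \<le> B * wt \<tau> (Re z)"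
      unfolding B_def
    proof (rule cauchy[where s = "r0 - r1" and k = 0])
      show "deriv (momentum F l) holomorphic_on strip (r0 - r1)"
      proof (rule holomorphic_deriv[OF _ open_strip])
        show "momentum F l holomorphic_on strip (r0 - r1)"
          by (rule holomorphic_on_subset[OF hp[OF l]]) (use r1 in \<open>auto simp: strip_def\<close>)
      qed
      show "norm (deriv (momentum F l) z - 0) \<le> G * C1 * wt \<tau> (Re z)" if "z \<in> strip (r0 - r1)" for z
        using cauchy[OF hp[OF l] b1[OF l] that] by simp
      show "z \<in> strip (r0 - r1 - r1)" using z r1 by simp
    qed
    show "norm (deriv (\<lambda>z. of_real l / momentum F l z) z) \<le> B * wt \<tau> (Re z)"
    proof (rule up, rule cauchy[OF _ b2[OF l] in1(1)[OF z]])
      show "(\<lambda>z. of_real l / momentum F l z) holomorphic_on strip r0"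
        using hp[OF l] p0[OF l] by (intro holomorphic_intros)
    qed
    show "norm (deriv (\<lambda>z. F z / momentum F l z) z) \<le> B * wt \<tau> (Re z)"
    proof (rule up, rule cauchy[OF _ b3[OF l] in1(1)[OF z]])
      show "(\<lambda>z. F z / momentum F l z) holomorphic_on strip r0"
        using hp[OF l] p0[OF l] hol0 by (intro holomorphic_intros)
    qed
  qed (use r1(1,2,5) r0 B in auto)
qed

end

section \<open>The energy of an involution\<close>

text \<open>On complex numbers \<open>\<bullet>\<close> is the real inner product of the plane, so
  this is the derivative of |U|^2, a form that stays differentiable at zeros of U.\<close>

lemma has_real_derivative_inner_self:
  fixes U :: "real \<Rightarrow> complex"
  assumes "(U has_vector_derivative U') (at t)"
  shows "((\<lambda>t. U t \<bullet> U t) has_real_derivative 2 * (U t \<bullet> U')) (at t)"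
  using bounded_bilinear.has_vector_derivative[OF bounded_bilinear_inner assms assms]
  by (simp add: has_real_derivative_iff_has_vector_derivative inner_commute)

lemma inner_le_half_squares:
  fixes x y :: complex
  shows "x \<bullet> (k * y) \<le> norm k * (x \<bullet> x + y \<bullet> y) / 2"
proof -
  have "x \<bullet> (k * y) \<le> norm x * (norm k * norm y)"
    using Cauchy_Schwarz_ineq2[of x "k * y"] by (simp add: norm_mult)
  also have "\<dots> = norm k * (norm x * norm y)" by simp
  also have "\<dots> \<le> norm k * ((x \<bullet> x + y \<bullet> y) / 2)"
    using sum_squares_bound[of "norm x" "norm y"]
    by (intro mult_left_mono) (auto simp: dot_square_norm)
  finally show ?thesis by simp
qed

text \<open>Multiplication by \<i> is skew for the real inner product, so the real part of
  \<open>k\<close> cancels between the two terms. This is why only Im \<kappa> drives the growth of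
  the energy.\<close>

lemma inner_ii_mult:
  fixes u v k :: complex
  shows "u \<bullet> (\<i> * k * v) + v \<bullet> (\<i> * k * u) = - 2 * Im k * (u \<bullet> v)"
  by (simp add: inner_complex_def algebra_simps)

text \<open>Here \<open>V = P U\<close> for the involution \<open>P\<close> with rows \<open>(-c, -\<i>d)\<close> and \<open>(\<i>d, c)\<close>, and
  \<open>U' = \<i>\<kappa> P U\<close>. Since \<open>P\<close> swaps \<open>U\<close> and \<open>V\<close> although it is not Hermitian, real \<open>\<kappa>\<close> and constant \<open>P\<close>
  would conserve \<open>|U|\<^sup>2 + |P U|\<^sup>2\<close>.\<close>

lemma involution_energy_derivative:
  fixes U1 U2 c d :: "real \<Rightarrow> complex" and \<kappa> :: complex
  defines "V1 \<equiv> \<lambda>t. - c t * U1 t - \<i> * d t * U2 t"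
    and "V2 \<equiv> \<lambda>t. \<i> * d t * U1 t + c t * U2 t"
  defines "E \<equiv> \<lambda>t. U1 t \<bullet> U1 t + U2 t \<bullet> U2 t + V1 t \<bullet> V1 t + V2 t \<bullet> V2 t"
  assumes U1: "(U1 has_vector_derivative \<i> * \<kappa> * V1 t) (at t)"
    and U2: "(U2 has_vector_derivative \<i> * \<kappa> * V2 t) (at t)"
    and c: "(c has_vector_derivative c') (at t)" and d: "(d has_vector_derivative d') (at t)"
    and cd: "(c t)\<^sup>2 + (d t)\<^sup>2 = 1"
  obtains E' where "(E has_real_derivative E') (at t)"
    "E' \<le> (2 * \<bar>Im \<kappa>\<bar> + norm c' + norm d') * E t"
proof -
  define E' where "E' = 2 * (U1 t \<bullet> (\<i> * \<kappa> * V1 t)) + 2 * (U2 t \<bullet> (\<i> * \<kappa> * V2 t))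
    + 2 * (V1 t \<bullet> (- c' * U1 t - \<i> * d' * U2 t + \<i> * \<kappa> * U1 t))
    + 2 * (V2 t \<bullet> (\<i> * d' * U1 t + c' * U2 t + \<i> * \<kappa> * U2 t))"
  have sq: "c t * c t + d t * d t = 1"
    using cd by (simp add: power2_eq_square)
  define v1 v2 where "v1 = V1 t" and "v2 = V2 t"
  note U12 = U1[folded v1_def] U2[folded v2_def]
  \<comment> \<open>V = P U gives V' = P' U + \<i> \<kappa> P V, and P V = P^2 U = U because c^2 +
    d^2 = 1. The second component goes the same way.\<close>
  have V1: "(V1 has_vector_derivative - c' * U1 t - \<i> * d' * U2 t + \<i> * \<kappa> * U1 t) (at t)"
  proof -
    have "(V1 has_vector_derivative
        - c t * (\<i> * \<kappa> * v1) + - c' * U1 t - (\<i> * d t * (\<i> * \<kappa> * v2) + \<i> * d' * U2 t)) (at t)"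
      unfolding V1_def
      by (intro has_vector_derivative_diff has_vector_derivative_mult has_vector_derivative_minus
        has_vector_derivative_mult_right U12 c d)
    moreover have "- c t * (\<i> * \<kappa> * v1) + - c' * U1 t - (\<i> * d t * (\<i> * \<kappa> * v2) + \<i> * d' * U2 t)
       = - c' * U1 t - \<i> * d' * U2 t + \<i> * \<kappa> * ((c t * c t + d t * d t) * U1 t)"
    proof -
      have "- c t * (\<i> * \<kappa> * v1) - \<i> * d t * (\<i> * \<kappa> * v2)
         = \<i> * \<kappa> * ((c t * c t - \<i> * \<i> * (d t * d t)) * U1 t)"
        unfolding v1_def v2_def V1_def V2_def by (simp add: algebra_simps)
      then show ?thesis by (simp add: algebra_simps)
    qed
    ultimately show ?thesis by (simp only: sq mult_1)
  qed
  have V2: "(V2 has_vector_derivative \<i> * d' * U1 t + c' * U2 t + \<i> * \<kappa> * U2 t) (at t)"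
  proof -
    have "(V2 has_vector_derivative
        (\<i> * d t * (\<i> * \<kappa> * v1) + \<i> * d' * U1 t) + (c t * (\<i> * \<kappa> * v2) + c' * U2 t)) (at t)"
      unfolding V2_def
      by (intro has_vector_derivative_add has_vector_derivative_mult
        has_vector_derivative_mult_right U12 c d)
    moreover have "(\<i> * d t * (\<i> * \<kappa> * v1) + \<i> * d' * U1 t) + (c t * (\<i> * \<kappa> * v2) + c' * U2 t)
       = \<i> * d' * U1 t + c' * U2 t + \<i> * \<kappa> * ((c t * c t + d t * d t) * U2 t)"
    proof -
      have "\<i> * d t * (\<i> * \<kappa> * v1) + c t * (\<i> * \<kappa> * v2)
         = \<i> * \<kappa> * ((c t * c t - \<i> * \<i> * (d t * d t)) * U2 t)"
        unfolding v1_def v2_def V1_def V2_def by (simp add: algebra_simps)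
      then show ?thesis by (simp add: algebra_simps)
    qed
    ultimately show ?thesis by (simp only: sq mult_1)
  qed
  have "(E has_real_derivative E') (at t)"
    unfolding E_def E'_def
    by (intro DERIV_add has_real_derivative_inner_self U1 U2 V1 V2)
  moreover have "E' \<le> (2 * \<bar>Im \<kappa>\<bar> + norm c' + norm d') * E t"
  proof -
    have k: "2 * (- 2 * Im \<kappa> * (u \<bullet> v)) \<le> 2 * \<bar>Im \<kappa>\<bar> * (u \<bullet> u + v \<bullet> v)" for u v :: complex
      using inner_le_half_squares[of u "of_real (- 2 * Im \<kappa>)" v]
      by (simp add: inner_complex_def algebra_simps)
    \<comment> \<open>The \<kappa> terms are paired, each component of U with that of V, which
      leaves only Im \<kappa>; the other four terms come from P'.\<close>
    have "E' = 2 * (- 2 * Im \<kappa> * (U1 t \<bullet> V1 t)) + 2 * (- 2 * Im \<kappa> * (U2 t \<bullet> V2 t))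
      + 2 * (V1 t \<bullet> (- c' * U1 t)) + 2 * (V1 t \<bullet> ((- \<i> * d') * U2 t))
      + 2 * (V2 t \<bullet> ((\<i> * d') * U1 t)) + 2 * (V2 t \<bullet> (c' * U2 t))"
      unfolding E'_def inner_ii_mult[symmetric] by (simp add: inner_add_right inner_diff_right)
    also have "\<dots> \<le> 2 * \<bar>Im \<kappa>\<bar> * (U1 t \<bullet> U1 t + V1 t \<bullet> V1 t) + 2 * \<bar>Im \<kappa>\<bar> * (U2 t \<bullet> U2 t + V2 t \<bullet> V2 t)
      + norm c' * (V1 t \<bullet> V1 t + U1 t \<bullet> U1 t) + norm d' * (V1 t \<bullet> V1 t + U2 t \<bullet> U2 t)
      + norm d' * (V2 t \<bullet> V2 t + U1 t \<bullet> U1 t) + norm c' * (V2 t \<bullet> V2 t + U2 t \<bullet> U2 t)"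
      using k[of "U1 t" "V1 t"] k[of "U2 t" "V2 t"]
        inner_le_half_squares[of "V1 t" "- c'" "U1 t"] inner_le_half_squares[of "V1 t" "- \<i> * d'" "U2 t"]
        inner_le_half_squares[of "V2 t" "\<i> * d'" "U1 t"] inner_le_half_squares[of "V2 t" "c'" "U2 t"]
      unfolding norm_mult norm_minus_cancel norm_ii mult_1 by linarith
    also have "\<dots> = (2 * \<bar>Im \<kappa>\<bar> + norm c' + norm d') * E t"
      unfolding E_def by (simp add: algebra_simps)
    finally show ?thesis .
  qed
  ultimately show thesis by (rule that)
qed

text \<open>Needed at the left end of the curve, where only |U| is known; at the right end |U|^2 <=
  E is immediate. Each of the two rows of P contributes 2 B^2.\<close>

lemma involution_norm_le:
  fixes U1 U2 c d :: complex
  assumes "norm c \<le> B" "norm d \<le> B"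
  defines "V1 \<equiv> - c * U1 - \<i> * d * U2" and "V2 \<equiv> \<i> * d * U1 + c * U2"
  shows "U1 \<bullet> U1 + U2 \<bullet> U2 + V1 \<bullet> V1 + V2 \<bullet> V2 \<le> (1 + 4 * B\<^sup>2) * ((norm U1)\<^sup>2 + (norm U2)\<^sup>2)"
proof -
  have *: "(norm (x + y))\<^sup>2 \<le> 2 * (B\<^sup>2 * ((norm U1)\<^sup>2 + (norm U2)\<^sup>2))"
    if "norm x \<le> B * norm U1" "norm y \<le> B * norm U2" for x y :: complex
  proof -
    have "(norm (x + y))\<^sup>2 \<le> (norm x + norm y)\<^sup>2"
      by (intro power_mono norm_triangle_ineq) simp
    also have "\<dots> \<le> 2 * ((norm x)\<^sup>2 + (norm y)\<^sup>2)"
      using sum_squares_bound[of "norm x" "norm y"] by (simp add: power2_sum)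
    also have "\<dots> \<le> 2 * ((B * norm U1)\<^sup>2 + (B * norm U2)\<^sup>2)"
      using that by (intro mult_left_mono add_mono power_mono) auto
    finally show ?thesis by (simp add: algebra_simps)
  qed
  have "(norm V1)\<^sup>2 \<le> 2 * (B\<^sup>2 * ((norm U1)\<^sup>2 + (norm U2)\<^sup>2))"
    using *[of "- c * U1" "- \<i> * d * U2"] assms by (simp add: V1_def norm_mult mult_right_mono)
  moreover have "(norm V2)\<^sup>2 \<le> 2 * (B\<^sup>2 * ((norm U1)\<^sup>2 + (norm U2)\<^sup>2))"
    using *[of "\<i> * d * U1" "c * U2"] assms by (simp add: V2_def norm_mult mult_right_mono)
  ultimately show ?thesis by (simp add: dot_square_norm algebra_simps)
qed

section \<open>The curve of almost constant phase\<close>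

context decaying_potential
begin

text \<open>The real part of \<open>\<gamma>' p(\<gamma>)\<close> only rotates phases, whereas its imaginary part, divided by
  \<open>\<epsilon>\<close>, is the rate of exponential growth. The height of \<open>\<gamma>\<close> above \<open>t\<close> is chosen as \<open>\<eta> / p(t)\<close> so that the
  contribution to it that is linear in \<open>\<eta>\<close> cancels.\<close>

lemma curve_estimates:
  fixes l s \<eta> \<delta> r1 B :: real
  defines "p \<equiv> momentum F l"
  defines "\<gamma> \<equiv> \<lambda>t::real. of_real t + \<i> * of_real (s * \<eta>) / p (of_real t)"
  assumes r1: "r1 \<le> r" and B: "B \<ge> 0" and \<delta>: "\<delta> > 0" and l: "l \<ge> \<delta>" and s: "\<bar>s\<bar> = 1"
    and \<eta>: "0 < \<eta>" "\<eta> < \<delta> * r1" "\<eta> \<le> 1"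
    and hp: "p holomorphic_on strip r1"
    and dp: "\<And>z. z \<in> strip r1 \<Longrightarrow> norm (deriv p z) \<le> B * wt \<tau> (Re z)"
    and ddp: "\<And>z. z \<in> strip r1 \<Longrightarrow> norm (deriv (deriv p) z) \<le> B * wt \<tau> (Re z)"
  shows "Re (\<gamma> t) = t" "Im (\<gamma> t) = s * \<eta> / sqrt (l\<^sup>2 + (A t)\<^sup>2)" "\<gamma> t \<in> strip r1"
    and "\<exists>\<gamma>'. (\<gamma> has_vector_derivative \<gamma>') (at t) \<and> norm \<gamma>' \<le> 1 + B / \<delta>\<^sup>2 \<and>
       \<bar>Im (\<gamma>' * p (\<gamma> t))\<bar> \<le> (B\<^sup>2 / \<delta>^3 + (1 + B / \<delta>\<^sup>2) * B / \<delta>\<^sup>2) * \<eta>\<^sup>2 * wt \<tau> t"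
proof -
  define q where "q = sqrt (l\<^sup>2 + (A t)\<^sup>2)"
  define h where "h = s * \<eta> / q"
  define q' where "q' = deriv p (of_real t)"
  have pt: "p (of_real t) = of_real q"
    unfolding p_def q_def by (rule momentum_of_real) (rule FA)
  have q: "q \<ge> \<delta>"
    using real_le_rsqrt[of \<delta> "l\<^sup>2 + (A t)\<^sup>2"] power_mono[of \<delta> l 2] l \<delta> by (auto simp: q_def add_increasing2)
  with \<delta> have q: "q \<ge> \<delta>" "q > 0" by auto
  have r10: "r1 > 0" using \<eta> \<delta> by (metis less_trans zero_less_mult_pos)
  have habs: "\<bar>h\<bar> \<le> \<eta> / \<delta>"
    unfolding h_def abs_divide abs_mult s using q \<delta> \<eta> by (simp add: frac_le)
  also have "\<dots> < r1" using \<eta> \<delta> by (simp add: field_simps)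
  finally have h_lt: "\<bar>h\<bar> < r1" .
  have \<gamma>t: "\<gamma> t = of_real t + \<i> * of_real h"
    by (simp add: \<gamma>_def pt h_def)
  show "Re (\<gamma> t) = t" "Im (\<gamma> t) = s * \<eta> / sqrt (l\<^sup>2 + (A t)\<^sup>2)"
    unfolding \<gamma>t by (simp_all add: h_def q_def)
  show in_strip: "\<gamma> t \<in> strip r1" using h_lt unfolding \<gamma>t by (simp add: strip_def)
  have dist: "norm (\<gamma> t - of_real t) = \<bar>h\<bar>" unfolding \<gamma>t by (simp add: norm_mult)
  have t_strip: "of_real t \<in> strip r1" using r10 by (simp add: strip_def)
  \<comment> \<open>The derivative of \<i> s \<eta> / p is - \<i> s \<eta> p' / p^2, which is - \<i>
    h q' / q since h = s \<eta> / q.\<close>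
  define \<gamma>' where "\<gamma>' = 1 - \<i> * of_real h * q' / of_real q"
  have 1: "(\<gamma> has_vector_derivative \<gamma>') (at t)"
  proof -
    have "(p has_field_derivative q') (at (of_real t))"
      unfolding q'_def by (rule holomorphic_derivI[OF hp open_strip t_strip])
    then have "((\<lambda>z. z + \<i> * of_real (s * \<eta>) / p z) has_field_derivative \<gamma>') (at (of_real t))"
      using q by (auto intro!: derivative_eq_intros simp: pt \<gamma>'_def h_def)
    from has_vector_derivative_real_field[OF this] show ?thesis by (simp add: \<gamma>_def[abs_def])
  qed
  have w: "wt \<tau> t \<le> 1" "wt \<tau> t \<ge> 0" using wt_le_1[OF \<tau>] wt_nonneg by auto
  have q'_le: "norm q' \<le> B * wt \<tau> t" using dp[OF t_strip] by (simp add: q'_def)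
  then have q'_le_B: "norm q' \<le> B" using mult_left_mono[OF w(1) B] by simp
  have 2: "norm \<gamma>' \<le> 1 + B / \<delta>\<^sup>2"
  proof -
    have "norm \<gamma>' \<le> 1 + \<bar>h\<bar> * norm q' / q"
      unfolding \<gamma>'_def using norm_triangle_ineq4[of 1 "\<i> * of_real h * q' / of_real q"] q
      by (simp add: norm_mult norm_divide)
    also have "\<bar>h\<bar> * norm q' / q \<le> (1 / \<delta>) * B / \<delta>"
    proof (intro frac_le mult_mono)
      have "\<eta> / \<delta> \<le> 1 / \<delta>" using \<eta> \<delta> by (intro divide_right_mono) auto
      then show "\<bar>h\<bar> \<le> 1 / \<delta>" using habs by linarith
    qed (use \<delta> q q'_le_B B in auto)
    finally show ?thesis by (simp add: power2_eq_square)
  qed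
  \<comment> \<open>The first-order Taylor remainder of \<open>p\<close> at \<open>t\<close>; it is
    O(h^2 \<open>wt\<close>) because the second derivative of \<open>p\<close> is
    O(\<open>wt\<close>) along the vertical segment.\<close>
  define R where "R = p (\<gamma> t) - of_real q - q' * (\<i> * of_real h)"
  have seg: "z \<in> strip r1 \<and> Re z = t" if "z \<in> closed_segment (of_real t) (\<gamma> t)" for z
  proof -
    from that obtain u where u: "0 \<le> u" "u \<le> 1" "z = (1 - u) *\<^sub>R of_real t + u *\<^sub>R \<gamma> t"
      by (auto simp: in_segment)
    then have "z = of_real t + \<i> * of_real (u * h)"
      unfolding \<gamma>t by (simp add: scaleR_conv_of_real algebra_simps)
    moreover have "\<bar>u * h\<bar> \<le> \<bar>h\<bar>" using u by (simp add: abs_mult mult_left_le_one_le)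
    ultimately show ?thesis using h_lt by (simp add: strip_def)
  qed
  have R: "norm R \<le> B * wt \<tau> t * h\<^sup>2"
  proof -
    have "norm ((deriv ^^ 0) p (\<gamma> t) - (\<Sum>i\<le>1. (deriv ^^ i) p (of_real t) * (\<gamma> t - of_real t) ^ i / fact i))
       \<le> (B * wt \<tau> t) * norm (\<gamma> t - of_real t) ^ Suc 1 / fact 1"
    proof (rule complex_Taylor[of "closed_segment (of_real t) (\<gamma> t)" 1 "\<lambda>i. (deriv ^^ i) p"])
      fix i z assume z: "z \<in> closed_segment (of_real t) (\<gamma> t)"
      show "((deriv ^^ i) p has_field_derivative (deriv ^^ Suc i) p z) (at z within closed_segment (of_real t) (\<gamma> t))"
        using has_field_derivative_higher_deriv[OF hp open_strip] seg[OF z] has_field_derivative_at_within by blast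
      show "norm ((deriv ^^ Suc 1) p z) \<le> B * wt \<tau> t"
        using ddp[of z] seg[OF z] by simp
    qed auto
    then show ?thesis unfolding dist R_def by (simp add: pt q'_def power2_eq_square \<gamma>t algebra_simps)
  qed
  have h2: "h\<^sup>2 \<le> \<eta>\<^sup>2 / \<delta>\<^sup>2"
    using power_mono[OF habs, of 2] by (simp add: power_divide)
  have 3: "\<bar>Im (\<gamma>' * p (\<gamma> t))\<bar> \<le> (B\<^sup>2 / \<delta>^3 + (1 + B / \<delta>\<^sup>2) * B / \<delta>\<^sup>2) * \<eta>\<^sup>2 * wt \<tau> t"
  proof -
    \<comment> \<open>In (1 - \<i> h q'/q)(q + \<i> h q') the terms linear in h cancel and q is
      real, so the imaginary part stems from h^2 q'^2 / q and \<gamma>' R alone, both of order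
      \<eta>^2.\<close>
    have "\<gamma>' * p (\<gamma> t) = \<gamma>' * (of_real q + q' * (\<i> * of_real h) + R)" by (simp add: R_def)
    also have "\<dots> = of_real q + of_real (h\<^sup>2) * q'\<^sup>2 / of_real q + \<gamma>' * R"
      unfolding \<gamma>'_def using q by (simp add: field_simps power2_eq_square)
    finally have "Im (\<gamma>' * p (\<gamma> t)) = Im (of_real (h\<^sup>2) * q'\<^sup>2 / of_real q + \<gamma>' * R)" by simp
    then have "\<bar>Im (\<gamma>' * p (\<gamma> t))\<bar> \<le> norm (of_real (h\<^sup>2) * q'\<^sup>2 / of_real q + \<gamma>' * R)"
      by (metis abs_Im_le_cmod)
    also have "\<dots> \<le> h\<^sup>2 * (norm q')\<^sup>2 / q + norm \<gamma>' * norm R"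
      using q by (intro order_trans[OF norm_triangle_ineq]) (simp add: norm_mult norm_divide norm_power)
    also have "\<dots> \<le> (\<eta>\<^sup>2 / \<delta>\<^sup>2) * (B * (B * wt \<tau> t)) / \<delta> + (1 + B / \<delta>\<^sup>2) * (B * wt \<tau> t * (\<eta>\<^sup>2 / \<delta>\<^sup>2))"
    proof (intro add_mono frac_le mult_mono)
      show "(norm q')\<^sup>2 \<le> B * (B * wt \<tau> t)"
        using mult_mono[OF q'_le_B q'_le] B by (simp add: power2_eq_square)
      have "B * wt \<tau> t * h\<^sup>2 \<le> B * wt \<tau> t * (\<eta>\<^sup>2 / \<delta>\<^sup>2)"
        using h2 B w by (intro mult_left_mono) auto
      then show "norm R \<le> B * wt \<tau> t * (\<eta>\<^sup>2 / \<delta>\<^sup>2)" using R by linarith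
    qed (use h2 2 q \<delta> B w in auto)
    also have "\<dots> = (B\<^sup>2 / \<delta>^3 + (1 + B / \<delta>\<^sup>2) * B / \<delta>\<^sup>2) * \<eta>\<^sup>2 * wt \<tau> t"
      using \<delta> by (simp add: field_simps power2_eq_square power3_eq_cube)
    finally show ?thesis .
  qed
  show "\<exists>\<gamma>'. (\<gamma> has_vector_derivative \<gamma>') (at t) \<and> norm \<gamma>' \<le> 1 + B / \<delta>\<^sup>2 \<and>
       \<bar>Im (\<gamma>' * p (\<gamma> t))\<bar> \<le> (B\<^sup>2 / \<delta>^3 + (1 + B / \<delta>\<^sup>2) * B / \<delta>\<^sup>2) * \<eta>\<^sup>2 * wt \<tau> t"
    using 1 2 3 by blast
qed

end

section \<open>Linearity and norm conservation on the real axis\<close>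

lemma ZS_solution_diff:
  assumes "ZS_solution A \<epsilon> lam u1 u2" "ZS_solution A \<epsilon> lam v1 v2"
  shows "ZS_solution A \<epsilon> lam (\<lambda>x. u1 x - v1 x) (\<lambda>x. u2 x - v2 x)"
  unfolding ZS_solution_def
proof (intro allI conjI)
  fix x
  show "((\<lambda>x. u1 x - v1 x) has_vector_derivative
      \<i> / of_real \<epsilon> * (- of_real lam * (u1 x - v1 x) - \<i> * of_real (A x) * (u2 x - v2 x))) (at x)"
    using assms unfolding ZS_solution_def
    by (auto intro!: has_vector_derivative_eq_rhs[OF has_vector_derivative_diff] simp: algebra_simps)
  show "((\<lambda>x. u2 x - v2 x) has_vector_derivative
      \<i> / of_real \<epsilon> * (\<i> * of_real (A x) * (u1 x - v1 x) + of_real lam * (u2 x - v2 x))) (at x)"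
    using assms unfolding ZS_solution_def
    by (auto intro!: has_vector_derivative_eq_rhs[OF has_vector_derivative_diff] simp: algebra_simps)
qed

text \<open>For real \<open>A\<close> and \<open>lam\<close> the matrix M is Hermitian, so \<i> M /
  \<epsilon> generates a unitary flow. Applied to differences this yields uniqueness, applied to
  Jost solutions it yields unitarity of the scattering.\<close>

lemma ZS_solution_norm:
  assumes "ZS_solution A \<epsilon> lam u1 u2"
  shows "(norm (u1 x))\<^sup>2 + (norm (u2 x))\<^sup>2 = (norm (u1 y))\<^sup>2 + (norm (u2 y))\<^sup>2"
proof -
  have D: "((\<lambda>x. u1 x \<bullet> u1 x + u2 x \<bullet> u2 x) has_real_derivative 0) (at x)" for x
  proof -
    let ?d1 = "\<i> / of_real \<epsilon> * (- of_real lam * u1 x - \<i> * of_real (A x) * u2 x)"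
    let ?d2 = "\<i> / of_real \<epsilon> * (\<i> * of_real (A x) * u1 x + of_real lam * u2 x)"
    have "((\<lambda>x. u1 x \<bullet> u1 x + u2 x \<bullet> u2 x) has_real_derivative
        2 * (u1 x \<bullet> ?d1) + 2 * (u2 x \<bullet> ?d2)) (at x)"
      using assms unfolding ZS_solution_def by (intro DERIV_add has_real_derivative_inner_self) auto
    moreover have "\<i> / of_real \<epsilon> = \<i> * of_real (1 / \<epsilon>)" by simp
    then have "2 * (u1 x \<bullet> ?d1) + 2 * (u2 x \<bullet> ?d2) = 0"
      by (simp only: inner_complex_def complex_eq_iff) (simp add: algebra_simps)
    ultimately show ?thesis by simp
  qed
  from DERIV_isconst_all[of "\<lambda>x. u1 x \<bullet> u1 x + u2 x \<bullet> u2 x" x y] D show ?thesis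
    by (simp add: dot_square_norm)
qed

section \<open>Holomorphic extension of solutions\<close>

text \<open>A Gronwall estimate along the vertical line through \<open>z\<close> first gives the
  crude bound n exp (2 D) for |w|^2. Inserted into the equation it makes the derivatives
  O(\<open>wt\<close>) on the segment, and the mean value inequality over a length of at most 1 does
  the rest.\<close>

lemma vertical_transfer:
  fixes g k w1 w2 :: "complex \<Rightarrow> complex"
  assumes w1: "\<And>z. z \<in> strip r \<Longrightarrow> (w1 has_field_derivative g z * w2 z) (at z)"
    and w2: "\<And>z. z \<in> strip r \<Longrightarrow> (w2 has_field_derivative k z * w1 z) (at z)"
    and \<tau>: "\<tau> > 0" and D: "D \<ge> 0"
    and g: "\<And>z. z \<in> strip r \<Longrightarrow> norm (g z) \<le> D * wt \<tau> (Re z)"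
    and k: "\<And>z. z \<in> strip r \<Longrightarrow> norm (k z) \<le> D * wt \<tau> (Re z)"
    and z: "z \<in> strip r" "\<bar>Im z\<bar> \<le> 1"
    and n: "(norm (w1 (of_real (Re z))))\<^sup>2 + (norm (w2 (of_real (Re z))))\<^sup>2 = n"
  shows "norm (w1 z - w1 (of_real (Re z))) \<le> D * wt \<tau> (Re z) * sqrt (n * exp (2 * D))"
    and "norm (w2 z - w2 (of_real (Re z))) \<le> D * wt \<tau> (Re z) * sqrt (n * exp (2 * D))"
proof -
  let ?x = "of_real (Re z) :: complex"
  define N where "N = (\<lambda>z. (norm (w1 z))\<^sup>2 + (norm (w2 z))\<^sup>2)"
  have N: "N y \<le> n * exp (2 * D)" if y: "y \<in> strip r" "\<bar>Im y\<bar> \<le> 1" "Re y = Re z" for y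
  proof -
    define a where "a = \<i> * of_real (Im y)"
    define \<zeta> where "\<zeta> = (\<lambda>s::real. ?x + of_real s * a)"
    have \<zeta>: "\<zeta> s \<in> strip r" "Re (\<zeta> s) = Re z" if "0 \<le> s" "s \<le> 1" for s
    proof -
      have "\<bar>s * Im y\<bar> \<le> \<bar>Im y\<bar>" using that by (simp add: abs_mult mult_left_le_one_le)
      then show "\<zeta> s \<in> strip r" "Re (\<zeta> s) = Re z" using y by (auto simp: \<zeta>_def a_def strip_def)
    qed
    have d\<zeta>: "(\<zeta> has_vector_derivative a) (at s)" for s
      unfolding \<zeta>_def by (auto intro!: derivative_eq_intros simp: has_vector_derivative_def scaleR_conv_of_real)
    define E where "E = (\<lambda>s. w1 (\<zeta> s) \<bullet> w1 (\<zeta> s) + w2 (\<zeta> s) \<bullet> w2 (\<zeta> s))"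
    define E' where "E' = (\<lambda>s. 2 * (w1 (\<zeta> s) \<bullet> (a * g (\<zeta> s) * w2 (\<zeta> s))) + 2 * (w2 (\<zeta> s) \<bullet> (a * k (\<zeta> s) * w1 (\<zeta> s))))"
    have "E 1 \<le> E 0 * exp (2 * D * 1 - 2 * D * 0)"
    proof (rule gronwall)
      fix s :: real assume s: "0 \<le> s" "s \<le> 1"
      have "((w1 \<circ> \<zeta>) has_vector_derivative a * (g (\<zeta> s) * w2 (\<zeta> s))) (at s)"
        "((w2 \<circ> \<zeta>) has_vector_derivative a * (k (\<zeta> s) * w1 (\<zeta> s))) (at s)"
        by (intro field_vector_diff_chain_at d\<zeta> w1 w2 \<zeta> s)+
      then show "(E has_real_derivative E' s) (at s)"
        unfolding E_def E'_def by (intro DERIV_add has_real_derivative_inner_self) (auto simp: o_def mult.assoc)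
      have m: "norm (a * h) \<le> D" if "norm h \<le> D * wt \<tau> (Re (\<zeta> s))" for h
      proof -
        have "norm (a * h) \<le> 1 * (D * 1)" unfolding norm_mult
        proof (rule mult_mono)
          show "norm a \<le> 1" using y by (simp add: a_def norm_mult)
          show "norm h \<le> D * 1"
            using that mult_left_mono[OF wt_le_1[OF \<tau>] D] order_trans by blast
        qed auto
        then show ?thesis by simp
      qed
      have P: "w1 (\<zeta> s) \<bullet> w1 (\<zeta> s) + w2 (\<zeta> s) \<bullet> w2 (\<zeta> s) \<ge> 0" by simp
      have "w1 (\<zeta> s) \<bullet> (a * g (\<zeta> s) * w2 (\<zeta> s)) \<le> D * (w1 (\<zeta> s) \<bullet> w1 (\<zeta> s) + w2 (\<zeta> s) \<bullet> w2 (\<zeta> s)) / 2"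
        using inner_le_half_squares[of "w1 (\<zeta> s)" "a * g (\<zeta> s)" "w2 (\<zeta> s)"]
          mult_right_mono[OF m[OF g[OF \<zeta>(1)[OF s]]] P] by linarith
      moreover have "w2 (\<zeta> s) \<bullet> (a * k (\<zeta> s) * w1 (\<zeta> s)) \<le> D * (w1 (\<zeta> s) \<bullet> w1 (\<zeta> s) + w2 (\<zeta> s) \<bullet> w2 (\<zeta> s)) / 2"
        using inner_le_half_squares[of "w2 (\<zeta> s)" "a * k (\<zeta> s)" "w1 (\<zeta> s)"]
          mult_right_mono[OF m[OF k[OF \<zeta>(1)[OF s]]] P] by (simp add: add.commute)
      ultimately show "E' s \<le> 2 * D * E s"
        unfolding E_def E'_def by (simp add: mult.assoc)
      show "((\<lambda>s. 2 * D * s) has_real_derivative 2 * D) (at s)"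
        by (rule DERIV_cmult_Id)
    qed simp
    moreover have "\<zeta> 1 = y" using y by (simp add: \<zeta>_def a_def complex_eq_iff)
    ultimately show ?thesis using n by (simp add: E_def N_def \<zeta>_def dot_square_norm)
  qed
  have seg: "y \<in> strip r \<and> \<bar>Im y\<bar> \<le> 1 \<and> Re y = Re z" if "y \<in> closed_segment ?x z" for y
  proof -
    from that obtain u where u: "0 \<le> u" "u \<le> 1" "y = (1 - u) *\<^sub>R ?x + u *\<^sub>R z"
      by (auto simp: in_segment)
    have "\<bar>u * Im z\<bar> \<le> \<bar>Im z\<bar>" using u by (simp add: abs_mult mult_left_le_one_le)
    moreover have "Re y = Re z" "Im y = u * Im z" unfolding u(3) by (simp_all add: algebra_simps)
    ultimately show ?thesis using z by (auto simp: strip_def)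
  qed
  have le: "norm (w1 y) \<le> sqrt (n * exp (2 * D))" "norm (w2 y) \<le> sqrt (n * exp (2 * D))"
    if "y \<in> closed_segment ?x z" for y
  proof -
    have *: "N y \<le> n * exp (2 * D)" using N seg[OF that] by blast
    show "norm (w1 y) \<le> sqrt (n * exp (2 * D))"
      by (rule real_le_rsqrt, rule order_trans[OF _ *]) (simp add: N_def)
    show "norm (w2 y) \<le> sqrt (n * exp (2 * D))"
      by (rule real_le_rsqrt, rule order_trans[OF _ *]) (simp add: N_def)
  qed
  have dist: "norm (z - ?x) \<le> 1" using z by (simp add: cmod_def)
  have Dw: "D * wt \<tau> (Re z) \<ge> 0" using D wt_nonneg by simp
  have n0: "n \<ge> 0" unfolding n[symmetric] by simp
  have main: "norm (w z - w ?x) \<le> D * wt \<tau> (Re z) * sqrt (n * exp (2 * D))"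
    if w: "\<And>z. z \<in> strip r \<Longrightarrow> (w has_field_derivative h z * v z) (at z)"
      and h: "\<And>z. z \<in> strip r \<Longrightarrow> norm (h z) \<le> D * wt \<tau> (Re z)"
      and v: "\<And>y. y \<in> closed_segment ?x z \<Longrightarrow> norm (v y) \<le> sqrt (n * exp (2 * D))" for w h v
  proof -
    have "norm (w z - w ?x) \<le> (D * wt \<tau> (Re z) * sqrt (n * exp (2 * D))) * norm (z - ?x)"
    proof (rule field_differentiable_bound)
      fix y assume y: "y \<in> closed_segment ?x z"
      show "(w has_field_derivative h y * v y) (at y within closed_segment ?x z)"
        using w seg[OF y] has_field_derivative_at_within by blast
      show "norm (h y * v y) \<le> D * wt \<tau> (Re z) * sqrt (n * exp (2 * D))"
        unfolding norm_mult using h[of y] seg[OF y] v[OF y] Dw by (intro mult_mono) auto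
    qed auto
    also have "\<dots> \<le> (D * wt \<tau> (Re z) * sqrt (n * exp (2 * D))) * 1"
      using n0 by (intro mult_left_mono[OF dist] mult_nonneg_nonneg[OF Dw]) auto
    finally show ?thesis by simp
  qed
  show "norm (w1 z - w1 ?x) \<le> D * wt \<tau> (Re z) * sqrt (n * exp (2 * D))"
    by (rule main[OF w1 g le(2)])
  show "norm (w2 z - w2 ?x) \<le> D * wt \<tau> (Re z) * sqrt (n * exp (2 * D))"
    by (rule main[OF w2 k le(1)])
qed

context decaying_potential
begin

text \<open>The system is solved in the interaction picture \<open>w\<^sub>1 = e\<^bsup>\<i>\<lambda>z/\<epsilon>\<^esup> v\<^sub>1\<close>, \<open>w\<^sub>2 = e\<^bsup>-\<i>\<lambda>z/\<epsilon>\<^esup> v\<^sub>2\<close>, in which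
  the coefficients decay, so that moving vertically near \<open>\<plusminus>\<infinity>\<close> hardly changes \<open>w\<close>.\<close>

lemma ZS_holomorphic_extension:
  assumes u: "ZS_solution A \<epsilon> lam u1 u2"
  obtains v1 v2 D where
    "\<And>z. z \<in> strip r \<Longrightarrow> (v1 has_field_derivative \<i> / of_real \<epsilon> * (- of_real lam * v1 z - \<i> * F z * v2 z)) (at z)"
    "\<And>z. z \<in> strip r \<Longrightarrow> (v2 has_field_derivative \<i> / of_real \<epsilon> * (\<i> * F z * v1 z + of_real lam * v2 z)) (at z)"
    "\<And>z. z \<in> strip r \<Longrightarrow> \<bar>Im z\<bar> \<le> 1 \<Longrightarrow> \<bar>norm (v1 z) * exp (- (lam / \<epsilon> * Im z)) - norm (u1 (Re z))\<bar> \<le> D * wt \<tau> (Re z)"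
    "\<And>z. z \<in> strip r \<Longrightarrow> \<bar>Im z\<bar> \<le> 1 \<Longrightarrow> \<bar>norm (v2 z) * exp (lam / \<epsilon> * Im z) - norm (u2 (Re z))\<bar> \<le> D * wt \<tau> (Re z)"
proof -
  define \<mu> where "\<mu> = lam / \<epsilon>"
  define g where "g = (\<lambda>z. F z / of_real \<epsilon> * exp (2 * \<i> * of_real \<mu> * z))"
  define k where "k = (\<lambda>z. - (F z / of_real \<epsilon> * exp (- 2 * \<i> * of_real \<mu> * z)))"
  \<comment> \<open>\<open>K\<close>, and hence the final \<open>D\<close>, depends badly on
    \<epsilon> and \<open>lam\<close>. This is harmless: later \<open>D\<close> only multiplies a
    weight that tends to 0 when limits at the ends of the curve are taken.\<close>
  define K where "K = C / \<bar>\<epsilon>\<bar> * exp (2 * \<bar>\<mu>\<bar> * r)"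
  have K0: "K \<ge> 0" using C by (simp add: K_def)
  have gk: "norm (g z) \<le> K * wt \<tau> (Re z)" "norm (k z) \<le> K * wt \<tau> (Re z)" if z: "z \<in> strip r" for z
  proof -
    have ee: "x * Im z \<le> 2 * \<bar>\<mu>\<bar> * r" if "\<bar>x\<bar> = 2 * \<bar>\<mu>\<bar>" for x
    proof -
      have "x * Im z \<le> \<bar>x\<bar> * \<bar>Im z\<bar>" by (metis abs_ge_self abs_mult)
      also have "\<dots> \<le> 2 * \<bar>\<mu>\<bar> * r" using that z by (auto simp: strip_def intro!: mult_left_mono)
      finally show ?thesis .
    qed
    have e: "norm (exp (2 * \<i> * of_real \<mu> * z)) \<le> exp (2 * \<bar>\<mu>\<bar> * r)"
      "norm (exp (- 2 * \<i> * of_real \<mu> * z)) \<le> exp (2 * \<bar>\<mu>\<bar> * r)"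
      using ee[of "- 2 * \<mu>"] ee[of "2 * \<mu>"] by (simp_all only: norm_exp_eq_Re) (simp_all add: abs_mult)
    have Fz: "norm (F z / of_real \<epsilon>) \<le> C * wt \<tau> (Re z) / \<bar>\<epsilon>\<bar>"
      using bound[OF z] by (simp add: norm_divide divide_right_mono)
    have "norm (F z / of_real \<epsilon>) * norm (exp (2 * \<i> * of_real \<mu> * z)) \<le> C * wt \<tau> (Re z) / \<bar>\<epsilon>\<bar> * exp (2 * \<bar>\<mu>\<bar> * r)"
      "norm (F z / of_real \<epsilon>) * norm (exp (- 2 * \<i> * of_real \<mu> * z)) \<le> C * wt \<tau> (Re z) / \<bar>\<epsilon>\<bar> * exp (2 * \<bar>\<mu>\<bar> * r)"
      using C by (intro mult_mono e Fz norm_ge_zero divide_nonneg_nonneg mult_nonneg_nonneg wt_nonneg abs_ge_zero; simp)+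
    then show "norm (g z) \<le> K * wt \<tau> (Re z)" "norm (k z) \<le> K * wt \<tau> (Re z)"
      unfolding g_def k_def K_def norm_minus_cancel norm_mult[of "F z / of_real \<epsilon>"]
      by (simp_all add: mult_ac)
  qed
  have hol_gk: "g holomorphic_on strip r" "k holomorphic_on strip r"
    unfolding g_def k_def by (auto simp: divide_inverse intro!: holomorphic_intros hol)
  have "x \<le> K" if "x \<le> K * wt \<tau> t" for x t
    using that mult_left_mono[OF wt_le_1[OF \<tau>] K0, of t] by simp
  then have gk': "norm (g z) \<le> K" "norm (k z) \<le> K" if "z \<in> strip r" for z
    using gk[OF that] by blast+
  have "0 \<in> strip r" using r by (simp add: strip_def)
  then obtain w1 w2 where w0: "w1 0 = u1 0" "w2 0 = u2 0"
    and w1: "\<And>z. z \<in> strip r \<Longrightarrow> (w1 has_field_derivative g z * w2 z) (at z)"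
    and w2: "\<And>z. z \<in> strip r \<Longrightarrow> (w2 has_field_derivative k z * w1 z) (at z)"
    using holomorphic_linear_system_exists[OF convex_strip open_strip _ hol_gk gk'] by metis
  define v1 v2 where "v1 = (\<lambda>z. exp (- \<i> * of_real \<mu> * z) * w1 z)"
    and "v2 = (\<lambda>z. exp (\<i> * of_real \<mu> * z) * w2 z)"
  have v1: "(v1 has_field_derivative \<i> / of_real \<epsilon> * (- of_real lam * v1 z - \<i> * F z * v2 z)) (at z)"
    and v2: "(v2 has_field_derivative \<i> / of_real \<epsilon> * (\<i> * F z * v1 z + of_real lam * v2 z)) (at z)"
    if z: "z \<in> strip r" for z
  proof -
    have "exp (2 * \<i> * of_real \<mu> * z) * exp (- \<i> * of_real \<mu> * z) = exp (\<i> * of_real \<mu> * z)"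
      unfolding exp_add[symmetric] by (rule arg_cong[of _ _ exp]) algebra
    then have "g z * w2 z * exp (- \<i> * of_real \<mu> * z) = F z / of_real \<epsilon> * v2 z"
      unfolding g_def v2_def by (simp add: mult_ac)
    moreover have "(v1 has_field_derivative
        exp (- \<i> * of_real \<mu> * z) * (- \<i> * of_real \<mu>) * w1 z + g z * w2 z * exp (- \<i> * of_real \<mu> * z)) (at z)"
      unfolding v1_def by (rule derivative_eq_intros w1[OF z] refl)+ simp
    moreover have "exp (- \<i> * of_real \<mu> * z) * (- \<i> * of_real \<mu>) * w1 z + F z / of_real \<epsilon> * v2 z =
        \<i> / of_real \<epsilon> * (- of_real lam * v1 z - \<i> * F z * v2 z)"
      by (simp add: v1_def \<mu>_def algebra_simps)
    ultimately show "(v1 has_field_derivative \<i> / of_real \<epsilon> * (- of_real lam * v1 z - \<i> * F z * v2 z)) (at z)"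
      by simp
    have "exp (- 2 * \<i> * of_real \<mu> * z) * exp (\<i> * of_real \<mu> * z) = exp (- \<i> * of_real \<mu> * z)"
      unfolding exp_add[symmetric] by (rule arg_cong[of _ _ exp]) algebra
    then have "k z * w1 z * exp (\<i> * of_real \<mu> * z) = - F z / of_real \<epsilon> * v1 z"
      unfolding k_def v1_def by (simp add: mult_ac)
    moreover have "(v2 has_field_derivative
        exp (\<i> * of_real \<mu> * z) * (\<i> * of_real \<mu>) * w2 z + k z * w1 z * exp (\<i> * of_real \<mu> * z)) (at z)"
      unfolding v2_def by (rule derivative_eq_intros w2[OF z] refl)+ simp
    moreover have "exp (\<i> * of_real \<mu> * z) * (\<i> * of_real \<mu>) * w2 z + - F z / of_real \<epsilon> * v1 z =
        \<i> / of_real \<epsilon> * (\<i> * F z * v1 z + of_real lam * v2 z)"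
      by (simp add: v2_def \<mu>_def algebra_simps)
    ultimately show "(v2 has_field_derivative \<i> / of_real \<epsilon> * (\<i> * F z * v1 z + of_real lam * v2 z)) (at z)"
      by simp
  qed
  have "ZS_solution A \<epsilon> lam (\<lambda>x. v1 (of_real x)) (\<lambda>x. v2 (of_real x))"
    unfolding ZS_solution_def
  proof (intro allI conjI)
    fix x :: real
    have x: "of_real x \<in> strip r" using r by (simp add: strip_def)
    show "((\<lambda>x. v1 (of_real x)) has_vector_derivative
        \<i> / of_real \<epsilon> * (- of_real lam * v1 (of_real x) - \<i> * of_real (A x) * v2 (of_real x))) (at x)"
      using has_vector_derivative_real_field[OF v1[OF x]] by (simp add: FA)
    show "((\<lambda>x. v2 (of_real x)) has_vector_derivative
        \<i> / of_real \<epsilon> * (\<i> * of_real (A x) * v1 (of_real x) + of_real lam * v2 (of_real x))) (at x)"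
      using has_vector_derivative_real_field[OF v2[OF x]] by (simp add: FA)
  qed
  \<comment> \<open>Uniqueness: the difference of the two solutions vanishes at 0, and its norm is
    conserved.\<close>
  from ZS_solution_norm[OF ZS_solution_diff[OF u this], of _ 0]
  have "(norm (u1 x - v1 (of_real x)))\<^sup>2 + (norm (u2 x - v2 (of_real x)))\<^sup>2 = 0" for x
    by (simp add: v1_def v2_def w0)
  then have uv: "u1 x = v1 (of_real x)" "u2 x = v2 (of_real x)" for x
    by (simp_all add: sum_power2_eq_zero_iff)
  define n where "n = (norm (u1 0))\<^sup>2 + (norm (u2 0))\<^sup>2"
  have uw: "norm (u1 x) = norm (w1 (of_real x))" "norm (u2 x) = norm (w2 (of_real x))" for x
    by (simp_all add: uv v1_def v2_def norm_mult)
  have n: "(norm (w1 (of_real x)))\<^sup>2 + (norm (w2 (of_real x)))\<^sup>2 = n" for x :: real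
    unfolding uw[symmetric] n_def by (rule ZS_solution_norm[OF u])
  define D where "D = K * sqrt (n * exp (2 * K))"
  \<comment> \<open>|exp (- \<i> \<mu> z)| = exp (\<mu> Im z), so the real exponentials in the claim
    undo the passage from w to v.\<close>
  have wv: "norm (v1 z) * exp (- (\<mu> * Im z)) = norm (w1 z)"
    "norm (v2 z) * exp (\<mu> * Im z) = norm (w2 z)" for z
    by (simp_all add: v1_def v2_def norm_mult mult_ac exp_add[symmetric])
  show thesis
  proof (rule that[OF v1 v2])
    fix z assume z: "z \<in> strip r"
    assume z1: "\<bar>Im z\<bar> \<le> 1"
    note tr = vertical_transfer[OF w1 w2 \<tau> K0 gk z z1 n]
    show "\<bar>norm (v1 z) * exp (- (lam / \<epsilon> * Im z)) - norm (u1 (Re z))\<bar> \<le> D * wt \<tau> (Re z)"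
      unfolding \<mu>_def[symmetric] wv uw D_def
      using order_trans[OF norm_triangle_ineq3 tr(1)] by (simp add: mult_ac)
    show "\<bar>norm (v2 z) * exp (lam / \<epsilon> * Im z) - norm (u2 (Re z))\<bar> \<le> D * wt \<tau> (Re z)"
      unfolding \<mu>_def[symmetric] wv uw D_def
      using order_trans[OF norm_triangle_ineq3 tr(2)] by (simp add: mult_ac)
  qed
qed

end

section \<open>Exponential smallness of the transition amplitude\<close>

context decaying_potential
begin

lemma A_tendsto_0:
  assumes "(wt \<tau> \<longlongrightarrow> 0) G"
  shows "(A \<longlongrightarrow> 0) G"
proof (rule Lim_null_comparison)
  show "\<forall>\<^sub>F x in G. norm (A x) \<le> C * wt \<tau> x"
  proof (rule always_eventually, rule allI)
    fix x :: real
    have "norm (F (of_real x)) \<le> C * wt \<tau> x"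
      using bound[of "of_real x"] r by (simp add: strip_def)
    then show "norm (A x) \<le> C * wt \<tau> x" by (simp add: FA)
  qed
  show "((\<lambda>x. C * wt \<tau> x) \<longlongrightarrow> 0) G"
    using tendsto_mult_left[OF assms, of C] by simp
qed

text \<open>The error of moving off the real axis vanishes with the weight; what remains in the
  limit is the factor \<open>exp h0\<close> from the free exponential.\<close>

lemma norm_on_curve_tendsto:
  fixes h :: "real \<Rightarrow> real" and v :: "real \<Rightarrow> complex" and u :: "real \<Rightarrow> complex"
  assumes wt0: "(wt \<tau> \<longlongrightarrow> 0) G"
    and h: "(h \<longlongrightarrow> h0) G" and u: "((\<lambda>t. norm (u t)) \<longlongrightarrow> n) G"
    and le: "\<And>t. \<bar>norm (v t) * exp (- h t) - norm (u t)\<bar> \<le> D * wt \<tau> t"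
  shows "((\<lambda>t. norm (v t)) \<longlongrightarrow> n * exp h0) G"
proof -
  have "((\<lambda>t. norm (v t) * exp (- h t) - norm (u t)) \<longlongrightarrow> 0) G"
    by (rule Lim_null_comparison[where g = "\<lambda>t. D * wt \<tau> t"])
      (use le tendsto_mult_left[OF wt0, of D] in auto)
  from tendsto_mult[OF tendsto_add[OF this u] tendsto_exp[OF h]]
  show ?thesis by (simp add: mult.assoc exp_add[symmetric])
qed

text \<open>Balance of squared amplitudes: the energy is O(exp (-2 \<eta>/\<epsilon>)) in the left
  limit, grows by at most a constant times exp (2 \<eta>/\<epsilon>), and in the right limit
  dominates \<beta>^2 exp (2 \<eta>/\<epsilon>). Both \<open>\<eta>\<close> and \<open>K\<close> are
  fixed before \<epsilon> and \<open>lam\<close>.\<close>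

lemma transition_amplitude_bound:
  assumes \<delta>: "\<delta> > 0"
  obtains \<eta> K where "\<eta> > 0"
    "\<And>\<epsilon> lam u1 u2 \<beta>. \<epsilon> > 0 \<Longrightarrow> \<bar>lam\<bar> \<ge> \<delta> \<Longrightarrow> ZS_solution A \<epsilon> lam u1 u2 \<Longrightarrow>
      ((\<lambda>x. norm (u1 x)) \<longlongrightarrow> 0) at_bot \<Longrightarrow> ((\<lambda>x. norm (u2 x)) \<longlongrightarrow> 1) at_bot \<Longrightarrow>
      ((\<lambda>x. norm (u1 x)) \<longlongrightarrow> \<beta>) at_top \<Longrightarrow> \<beta> \<le> K * exp (- \<eta> / \<epsilon>)"
proof -
  obtain r1 B where r1: "0 < r1" "r1 \<le> r" "r1 \<le> 1" and B: "B > 0"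
    and hp: "\<And>l. l \<ge> \<delta> \<Longrightarrow> momentum F l holomorphic_on strip r1"
    and p_ge: "\<And>l z. l \<ge> \<delta> \<Longrightarrow> z \<in> strip r1 \<Longrightarrow> norm (momentum F l z) \<ge> l / 2"
    and Fp: "\<And>l z. l \<ge> \<delta> \<Longrightarrow> z \<in> strip r1 \<Longrightarrow> norm (F z / momentum F l z) \<le> B"
    and dp: "\<And>l z. l \<ge> \<delta> \<Longrightarrow> z \<in> strip r1 \<Longrightarrow> norm (deriv (momentum F l) z) \<le> B * wt \<tau> (Re z)"
    and ddp: "\<And>l z. l \<ge> \<delta> \<Longrightarrow> z \<in> strip r1 \<Longrightarrow> norm (deriv (deriv (momentum F l)) z) \<le> B * wt \<tau> (Re z)"
    and dc: "\<And>l z. l \<ge> \<delta> \<Longrightarrow> z \<in> strip r1 \<Longrightarrow> norm (deriv (\<lambda>z. of_real l / momentum F l z) z) \<le> B * wt \<tau> (Re z)"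
    and dd: "\<And>l z. l \<ge> \<delta> \<Longrightarrow> z \<in> strip r1 \<Longrightarrow> norm (deriv (\<lambda>z. F z / momentum F l z) z) \<le> B * wt \<tau> (Re z)"
    by (rule momentum_bounds[OF \<delta>]) (rule that)
  define M where "M = B\<^sup>2 / \<delta>^3 + (1 + B / \<delta>\<^sup>2) * B / \<delta>\<^sup>2"
  define Q where "Q = 1 + B / \<delta>\<^sup>2"
  have M: "M \<ge> 0" and Q: "Q \<ge> 0" using B \<delta> by (auto simp: M_def Q_def intro!: add_nonneg_nonneg)
  \<comment> \<open>The second entry keeps the curve inside the strip of half-width
    \<open>r1\<close>. The third makes the quadratic phase error, of size 4 M \<eta>^2 / \<tau>, at
    most 2 \<eta>; M + 1 avoids a zero denominator.\<close>
  define \<eta> where "\<eta> = min 1 (min (\<delta> * r1 / 2) (\<tau> / (2 * (M + 1))))"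
  have \<eta>: "0 < \<eta>" "\<eta> < \<delta> * r1" "\<eta> \<le> 1" "4 * M * \<eta>\<^sup>2 / \<tau> \<le> 2 * \<eta>"
  proof -
    show \<eta>0: "0 < \<eta>" using \<delta> r1 \<tau> M by (simp add: \<eta>_def)
    show "\<eta> \<le> 1" by (simp add: \<eta>_def)
    have "\<eta> \<le> \<delta> * r1 / 2" unfolding \<eta>_def by linarith
    moreover have "0 < \<delta> * r1" using \<delta> r1 by simp
    ultimately show "\<eta> < \<delta> * r1" by linarith
    have "\<eta> \<le> \<tau> / (2 * (M + 1))" unfolding \<eta>_def by linarith
    then have "2 * M * \<eta> + 2 * \<eta> \<le> \<tau>" using M by (simp add: field_simps)
    then have "2 * M * \<eta> \<le> \<tau>" using \<eta>0 by linarith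
    from mult_right_mono[OF this, of "2 * \<eta>"] \<eta>0 show "4 * M * \<eta>\<^sup>2 / \<tau> \<le> 2 * \<eta>"
      using \<tau> by (simp add: field_simps power2_eq_square)
  qed
  \<comment> \<open>Common bound for the entries of P: |c| = l/|p| <= 2 and |d| = |F/p| <=
    B.\<close>
  define B' where "B' = max B 2"
  define K where "K = sqrt ((1 + 4 * B'\<^sup>2) * exp (8 * Q * B / \<tau>))"
  show thesis
  proof (rule that[OF \<eta>(1)])
    fix \<epsilon> lam \<beta> :: real and u1 u2 :: "real \<Rightarrow> complex"
    assume \<epsilon>: "\<epsilon> > 0" and lam: "\<bar>lam\<bar> \<ge> \<delta>" and u: "ZS_solution A \<epsilon> lam u1 u2"
      and lims: "((\<lambda>x. norm (u1 x)) \<longlongrightarrow> 0) at_bot" "((\<lambda>x. norm (u2 x)) \<longlongrightarrow> 1) at_bot"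
        "((\<lambda>x. norm (u1 x)) \<longlongrightarrow> \<beta>) at_top"
    define l where "l = \<bar>lam\<bar>"
    define s where "s = sgn lam"
    have l: "l \<ge> \<delta>" and l0: "l > 0" using lam \<delta> by (auto simp: l_def)
    have s: "\<bar>s\<bar> = 1" "s * s = 1" and lam_sl: "lam = s * l"
      using l0 by (auto simp: s_def l_def sgn_if split: if_splits)
    define p where "p = momentum F l"
    define \<gamma> where "\<gamma> = (\<lambda>t::real. of_real t + \<i> * of_real (s * \<eta>) / p (of_real t))"
    have \<gamma>_app: "\<gamma> t = of_real t + \<i> * of_real (s * \<eta>) / p (of_real t)" for t
      by (simp add: \<gamma>_def)
    note curve = curve_estimates[OF r1(2) less_imp_le[OF B] \<delta> l s(1) \<eta>(1-3) hp[OF l] dp[OF l] ddp[OF l],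
        folded p_def, folded \<gamma>_app, folded M_def Q_def]
    obtain v1 v2 D where
      v1: "\<And>z. z \<in> strip r \<Longrightarrow> (v1 has_field_derivative \<i> / of_real \<epsilon> * (- of_real lam * v1 z - \<i> * F z * v2 z)) (at z)"
      and v2: "\<And>z. z \<in> strip r \<Longrightarrow> (v2 has_field_derivative \<i> / of_real \<epsilon> * (\<i> * F z * v1 z + of_real lam * v2 z)) (at z)"
      and D1: "\<And>z. z \<in> strip r \<Longrightarrow> \<bar>Im z\<bar> \<le> 1 \<Longrightarrow> \<bar>norm (v1 z) * exp (- (lam / \<epsilon> * Im z)) - norm (u1 (Re z))\<bar> \<le> D * wt \<tau> (Re z)"
      and D2: "\<And>z. z \<in> strip r \<Longrightarrow> \<bar>Im z\<bar> \<le> 1 \<Longrightarrow> \<bar>norm (v2 z) * exp (lam / \<epsilon> * Im z) - norm (u2 (Re z))\<bar> \<le> D * wt \<tau> (Re z)"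
      using ZS_holomorphic_extension[OF u] by metis
    have \<gamma>: "\<gamma> t \<in> strip r1" "\<gamma> t \<in> strip r" "\<bar>Im (\<gamma> t)\<bar> \<le> 1" for t
      using curve(3)[of t] r1 by (auto simp: strip_def)
    \<comment> \<open>The exponent gained by a free wave at height Im \<gamma>. Since A tends to 0,
      Im \<gamma> tends to s \<eta> / l at both ends; the sign s in the curve makes the limit of
      \<open>h\<close> equal to \<eta>/\<epsilon> for either sign of \<open>lam\<close>.\<close>
    define h where "h = (\<lambda>t. lam / \<epsilon> * Im (\<gamma> t))"
    have h_lim: "(h \<longlongrightarrow> \<eta> / \<epsilon>) G" if "(wt \<tau> \<longlongrightarrow> 0) G" for G
    proof -
      have "((\<lambda>t. lam / \<epsilon> * (s * \<eta> / sqrt (l\<^sup>2 + (A t)\<^sup>2))) \<longlongrightarrow> lam / \<epsilon> * (s * \<eta> / sqrt (l\<^sup>2 + 0\<^sup>2))) G"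
        using l0 by (intro tendsto_intros A_tendsto_0 that) auto
      moreover have "lam / \<epsilon> * (s * \<eta> / sqrt (l\<^sup>2 + 0\<^sup>2)) = (s * s) * \<eta> / \<epsilon>"
        using l0 by (simp add: lam_sl)
      ultimately show ?thesis by (simp add: h_def curve(2) s)
    qed
    define U1 U2 where "U1 = (\<lambda>t. v1 (\<gamma> t))" and "U2 = (\<lambda>t. v2 (\<gamma> t))"
    have U1_lim: "((\<lambda>t. norm (U1 t)) \<longlongrightarrow> n * exp (\<eta> / \<epsilon>)) G"
      if "(wt \<tau> \<longlongrightarrow> 0) G" "((\<lambda>x. norm (u1 x)) \<longlongrightarrow> n) G" for G n
      using D1[OF \<gamma>(2,3)] unfolding U1_def
      by (intro norm_on_curve_tendsto[OF that(1) h_lim[OF that(1)] that(2)]) (simp add: h_def curve(1))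
    have U2_lim: "((\<lambda>t. norm (U2 t)) \<longlongrightarrow> 1 * exp (- (\<eta> / \<epsilon>))) at_bot"
      using D2[OF \<gamma>(2,3)] unfolding U2_def
      by (intro norm_on_curve_tendsto[OF wt_tendsto_0(2)[OF \<tau>] tendsto_minus[OF h_lim] lims(2)] wt_tendsto_0 \<tau>)
        (simp add: h_def curve(1))
    \<comment> \<open>The entries of P = M / p. As \<open>p\<close> is built from |lam|, the sign of
      \<open>lam\<close> must reappear in \<open>c\<close>.\<close>
    define c d where "c = (\<lambda>t. of_real s * (of_real l / p (\<gamma> t)))" and "d = (\<lambda>t. F (\<gamma> t) / p (\<gamma> t))"
    define E where "E = (\<lambda>t. U1 t \<bullet> U1 t + U2 t \<bullet> U2 t
      + (- c t * U1 t - \<i> * d t * U2 t) \<bullet> (- c t * U1 t - \<i> * d t * U2 t)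
      + (\<i> * d t * U1 t + c t * U2 t) \<bullet> (\<i> * d t * U1 t + c t * U2 t))"
    \<comment> \<open>The first summand bounds 2 |Im \<kappa>|, the second the norms of the
      derivatives of \<open>c\<close> and \<open>d\<close>, each relative to the weight; only the
      first is singular in \<epsilon>.\<close>
    define k where "k = 2 * (M * \<eta>\<^sup>2 / \<epsilon>) + 2 * (Q * B)"
    have p0: "p z \<noteq> 0" if "z \<in> strip r1" for z
      using p_ge[OF l that] l0 by (auto simp: p_def)
    have "\<exists>E'. (E has_real_derivative E') (at t) \<and> E' \<le> k * wt \<tau> t * E t" for t
    proof -
      from curve(4)[of t] obtain \<gamma>' where \<gamma>': "(\<gamma> has_vector_derivative \<gamma>') (at t)" "norm \<gamma>' \<le> Q"
        "\<bar>Im (\<gamma>' * p (\<gamma> t))\<bar> \<le> M * \<eta>\<^sup>2 * wt \<tau> t" by blast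
      define \<kappa> where "\<kappa> = \<gamma>' * p (\<gamma> t) / of_real \<epsilon>"
      note pt = p0[OF \<gamma>(1)[of t]]
      have "(U1 has_vector_derivative \<gamma>' * (\<i> / of_real \<epsilon> * (- of_real lam * v1 (\<gamma> t) - \<i> * F (\<gamma> t) * v2 (\<gamma> t)))) (at t)"
        using field_vector_diff_chain_at[OF \<gamma>'(1) v1[OF \<gamma>(2)]] by (simp add: o_def U1_def)
      then have 1: "(U1 has_vector_derivative \<i> * \<kappa> * (- c t * U1 t - \<i> * d t * U2 t)) (at t)"
        by (rule has_vector_derivative_eq_rhs)
          (use pt \<epsilon> in \<open>simp add: \<kappa>_def c_def d_def U1_def U2_def lam_sl field_simps\<close>)
      have "(U2 has_vector_derivative \<gamma>' * (\<i> / of_real \<epsilon> * (\<i> * F (\<gamma> t) * v1 (\<gamma> t) + of_real lam * v2 (\<gamma> t)))) (at t)"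
        using field_vector_diff_chain_at[OF \<gamma>'(1) v2[OF \<gamma>(2)]] by (simp add: o_def U2_def)
      then have 2: "(U2 has_vector_derivative \<i> * \<kappa> * (\<i> * d t * U1 t + c t * U2 t)) (at t)"
        by (rule has_vector_derivative_eq_rhs)
          (use pt \<epsilon> in \<open>simp add: \<kappa>_def c_def d_def U1_def U2_def lam_sl field_simps\<close>)
      have chain: "((\<lambda>t. f (\<gamma> t)) has_vector_derivative \<gamma>' * deriv f (\<gamma> t)) (at t)"
        if "f holomorphic_on strip r1" for f
        using field_vector_diff_chain_at[OF \<gamma>'(1) holomorphic_derivI[OF that open_strip \<gamma>(1)]]
        by (simp add: o_def)
      define c' d' where "c' = of_real s * (\<gamma>' * deriv (\<lambda>z. of_real l / p z) (\<gamma> t))"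
        and "d' = \<gamma>' * deriv (\<lambda>z. F z / p z) (\<gamma> t)"
      have 3: "(c has_vector_derivative c') (at t)"
        unfolding c_def c'_def using hp[OF l] p0
        by (intro has_vector_derivative_mult_right chain holomorphic_intros) (auto simp: p_def)
      have "F holomorphic_on strip r1"
        by (rule holomorphic_on_subset[OF hol]) (use r1 in \<open>auto simp: strip_def\<close>)
      then have 4: "(d has_vector_derivative d') (at t)"
        unfolding d_def d'_def using hp[OF l] p0
        by (intro chain holomorphic_intros) (auto simp: p_def)
      have ss: "(of_real s)\<^sup>2 = (1::complex)" using s(2) by (metis of_real_1 of_real_power power2_eq_square)
      have "(c t)\<^sup>2 + (d t)\<^sup>2 = (of_real (l\<^sup>2) + (F (\<gamma> t))\<^sup>2) / (p (\<gamma> t))\<^sup>2"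
        by (simp add: c_def d_def power_mult_distrib power_divide ss add_divide_distrib)
      also have "\<dots> = 1" using pt unfolding momentum_sq[symmetric] p_def by simp
      finally have 5: "(c t)\<^sup>2 + (d t)\<^sup>2 = 1" .
      have "\<exists>E'. (E has_real_derivative E') (at t) \<and> E' \<le> (2 * \<bar>Im \<kappa>\<bar> + norm c' + norm d') * E t"
        unfolding E_def by (rule involution_energy_derivative[OF 1 2 3 4 5]) (intro exI conjI)
      then obtain E' where E': "(E has_real_derivative E') (at t)"
        "E' \<le> (2 * \<bar>Im \<kappa>\<bar> + norm c' + norm d') * E t" by blast
      have "\<bar>Im \<kappa>\<bar> \<le> M * \<eta>\<^sup>2 / \<epsilon> * wt \<tau> t"
        using divide_right_mono[OF \<gamma>'(3), of \<epsilon>] \<epsilon> by (simp add: \<kappa>_def)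
      moreover have "norm c' \<le> Q * (B * wt \<tau> t)"
        unfolding c'_def norm_mult norm_of_real s(1) mult_1
        using \<gamma>'(2) dc[OF l \<gamma>(1)[of t]] Q by (intro mult_mono) (auto simp: curve(1) p_def)
      moreover have "norm d' \<le> Q * (B * wt \<tau> t)"
        unfolding d'_def norm_mult
        using \<gamma>'(2) dd[OF l \<gamma>(1)[of t]] Q by (intro mult_mono) (auto simp: curve(1) p_def)
      moreover have "k * wt \<tau> t = 2 * (M * \<eta>\<^sup>2 / \<epsilon> * wt \<tau> t) + 2 * (Q * (B * wt \<tau> t))"
        by (simp add: k_def algebra_simps)
      ultimately have "2 * \<bar>Im \<kappa>\<bar> + norm c' + norm d' \<le> k * wt \<tau> t"
        by linarith
      moreover have "E t \<ge> 0" by (simp add: E_def)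
      ultimately have "E' \<le> k * wt \<tau> t * E t"
        by (rule order_trans[OF E'(2) mult_right_mono])
      then show ?thesis using E'(1) by blast
    qed
    then obtain E' where E': "\<And>t. (E has_real_derivative E' t) (at t)" "\<And>t. E' t \<le> k * wt \<tau> t * E t"
      by metis
    have k0: "k \<ge> 0" using M Q B \<epsilon> by (simp add: k_def)
    have E_le: "E t \<le> (1 + 4 * B'\<^sup>2) * ((norm (U1 t))\<^sup>2 + (norm (U2 t))\<^sup>2)" for t
      unfolding E_def
    proof (rule involution_norm_le)
      have "norm (c t) = l / norm (p (\<gamma> t))" using s l0 by (simp add: c_def norm_mult norm_divide)
      also have "\<dots> \<le> 2" using p_ge[OF l \<gamma>(1)[of t]] p0[OF \<gamma>(1)[of t]] by (simp add: field_simps p_def)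
      finally show "norm (c t) \<le> B'" by (simp add: B'_def)
      show "norm (d t) \<le> B'" using Fp[OF l \<gamma>(1)[of t]] by (simp add: B'_def d_def p_def)
    qed
    have ineq: "(norm (U1 y))\<^sup>2 \<le> (1 + 4 * B'\<^sup>2) * ((norm (U1 x))\<^sup>2 + (norm (U2 x))\<^sup>2) * exp (2 * k / \<tau>)"
      if "x \<le> 0" "0 \<le> y" for x y
    proof -
      have "(norm (U1 y))\<^sup>2 \<le> E y" by (simp add: E_def dot_square_norm)
      also have "\<dots> \<le> E x * exp (2 * k / \<tau>)"
        by (rule gronwall_wt[OF \<tau> k0 that E']) (simp add: E_def)
      also have "\<dots> \<le> (1 + 4 * B'\<^sup>2) * ((norm (U1 x))\<^sup>2 + (norm (U2 x))\<^sup>2) * exp (2 * k / \<tau>)"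
        by (intro mult_right_mono E_le) simp
      finally show ?thesis .
    qed
    \<comment> \<open>The right end point is sent to infinity first with \<open>x\<close> fixed; the
      limit of \<open>x\<close> at minus infinity follows.\<close>
    have 1: "(\<beta> * exp (\<eta> / \<epsilon>))\<^sup>2 \<le> (1 + 4 * B'\<^sup>2) * ((norm (U1 x))\<^sup>2 + (norm (U2 x))\<^sup>2) * exp (2 * k / \<tau>)"
      if "x \<le> 0" for x
      by (rule tendsto_upperbound[OF tendsto_power[OF U1_lim[OF wt_tendsto_0(1)[OF \<tau>] lims(3)]]])
        (auto intro: eventually_mono[OF eventually_ge_at_top[of 0]] ineq[OF that])
    have "(\<beta> * exp (\<eta> / \<epsilon>))\<^sup>2 \<le> (1 + 4 * B'\<^sup>2) * ((0 * exp (\<eta> / \<epsilon>))\<^sup>2 + (1 * exp (- (\<eta> / \<epsilon>)))\<^sup>2) * exp (2 * k / \<tau>)"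
    proof (rule tendsto_lowerbound)
      show "((\<lambda>x. (1 + 4 * B'\<^sup>2) * ((norm (U1 x))\<^sup>2 + (norm (U2 x))\<^sup>2) * exp (2 * k / \<tau>)) \<longlongrightarrow>
          (1 + 4 * B'\<^sup>2) * ((0 * exp (\<eta> / \<epsilon>))\<^sup>2 + (1 * exp (- (\<eta> / \<epsilon>)))\<^sup>2) * exp (2 * k / \<tau>)) at_bot"
        by (intro tendsto_intros U1_lim U2_lim wt_tendsto_0 \<tau> lims)
      show "\<forall>\<^sub>F x in at_bot. (\<beta> * exp (\<eta> / \<epsilon>))\<^sup>2 \<le> (1 + 4 * B'\<^sup>2) * ((norm (U1 x))\<^sup>2 + (norm (U2 x))\<^sup>2) * exp (2 * k / \<tau>)"
        by (rule eventually_mono[OF eventually_le_at_bot[of 0]]) (rule 1)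
    qed simp
    then have "\<beta>\<^sup>2 * exp (\<eta> / \<epsilon>)^2 \<le> (1 + 4 * B'\<^sup>2) * (exp (- (\<eta> / \<epsilon>))^2 * exp (2 * k / \<tau>))"
      by (simp add: power_mult_distrib)
    also have "exp (- (\<eta> / \<epsilon>))^2 * exp (2 * k / \<tau>) \<le> exp (8 * Q * B / \<tau>)"
    proof -
      \<comment> \<open>The choice of \<open>\<eta>\<close> turns the \<epsilon>-dependent part into
        at most 2 \<eta>/\<epsilon>, which exp (- \<eta>/\<epsilon>)^2 compensates; the remainder is
        rounded up to the exponent in \<open>K\<close>.\<close>
      have "2 * k / \<tau> = (4 * M * \<eta>\<^sup>2 / \<tau>) / \<epsilon> + 4 * Q * B / \<tau>"
        using \<epsilon> \<tau> by (simp add: k_def field_simps)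
      also have "\<dots> \<le> 2 * \<eta> / \<epsilon> + 8 * Q * B / \<tau>"
        using \<eta>(4) \<epsilon> Q B \<tau> by (intro add_mono divide_right_mono) auto
      finally show ?thesis by (simp add: exp_double[symmetric] exp_add[symmetric])
    qed
    finally have "\<beta>\<^sup>2 * exp (\<eta> / \<epsilon>)^2 \<le> (1 + 4 * B'\<^sup>2) * exp (8 * Q * B / \<tau>)"
      by (simp add: add_pos_nonneg)
    then have "\<beta> * exp (\<eta> / \<epsilon>) \<le> K"
      unfolding K_def by (intro real_le_rsqrt) (simp add: power_mult_distrib)
    then have "\<beta> * exp (\<eta> / \<epsilon>) * exp (- \<eta> / \<epsilon>) \<le> K * exp (- \<eta> / \<epsilon>)"
      by (rule mult_right_mono) simp
    then show "\<beta> \<le> K * exp (- \<eta> / \<epsilon>)" by (simp add: mult.assoc exp_add[symmetric])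
  qed
qed

end

section \<open>Scattering coefficients as limits, unitarity and the conclusion\<close>

lemma norm_tendsto_of_diff:
  fixes f g :: "real \<Rightarrow> 'a::real_normed_vector"
  assumes "((\<lambda>x. f x - g x) \<longlongrightarrow> 0) G" "\<And>x. norm (g x) = n"
  shows "((\<lambda>x. norm (f x)) \<longlongrightarrow> n) G"
proof -
  have "((\<lambda>x. norm (f x) - n) \<longlongrightarrow> 0) G"
  proof (rule Lim_null_comparison[OF always_eventually tendsto_norm_zero[OF assms(1)]], rule allI)
    fix x
    show "norm (norm (f x) - n) \<le> norm (f x - g x)"
      using norm_triangle_ineq3[of "f x" "g x"] assms(2)[of x] by simp
  qed
  then show ?thesis by (simp add: LIM_zero_iff)
qed

lemma jost_plus_tendsto:
  assumes "jost_plus A \<epsilon> lam G u1 u2"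
  shows "((\<lambda>x. norm (u1 x)) \<longlongrightarrow> 0) G" "((\<lambda>x. norm (u2 x)) \<longlongrightarrow> 1) G"
proof -
  show "((\<lambda>x. norm (u1 x)) \<longlongrightarrow> 0) G"
    using assms unfolding jost_plus_def by (blast intro: tendsto_norm_zero)
  have "((\<lambda>x. u2 x - exp (\<i> * complex_of_real (lam * x / \<epsilon>))) \<longlongrightarrow> 0) G"
    using assms unfolding jost_plus_def by blast
  then show "((\<lambda>x. norm (u2 x)) \<longlongrightarrow> 1) G"
    by (rule norm_tendsto_of_diff) simp
qed

text \<open>At plus infinity the two right Jost solutions are free waves of modulus 1 in different
  components, so |a| and |b| can be read off separately from the components of the left
  solution.\<close>

lemma scattering_limits:
  assumes "scattering_ab A \<epsilon> lam a b"
  obtains u1 u2 where "ZS_solution A \<epsilon> lam u1 u2"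
    "((\<lambda>x. norm (u1 x)) \<longlongrightarrow> 0) at_bot" "((\<lambda>x. norm (u2 x)) \<longlongrightarrow> 1) at_bot"
    "((\<lambda>x. norm (u1 x)) \<longlongrightarrow> norm b) at_top" "((\<lambda>x. norm (u2 x)) \<longlongrightarrow> norm a) at_top"
proof -
  from assms obtain p1 p2 m1 m2 u1 u2 where p: "jost_plus A \<epsilon> lam at_top p1 p2"
    and m: "jost_minus A \<epsilon> lam at_top m1 m2" and u: "jost_plus A \<epsilon> lam at_bot u1 u2"
    and eq: "\<And>x. u1 x = a * p1 x + b * m1 x" "\<And>x. u2 x = a * p2 x + b * m2 x"
    unfolding scattering_ab_def by blast
  let ?e = "\<lambda>x. exp (\<i> * complex_of_real (lam * x / \<epsilon>))"
  let ?e' = "\<lambda>x. exp (- \<i> * complex_of_real (lam * x / \<epsilon>))"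
  have "((\<lambda>x. a * p1 x + b * (m1 x - ?e' x)) \<longlongrightarrow> a * 0 + b * 0) at_top"
    using p m unfolding jost_plus_def jost_minus_def by (intro tendsto_intros) auto
  then have "((\<lambda>x. u1 x - b * ?e' x) \<longlongrightarrow> 0) at_top" by (simp add: eq algebra_simps)
  then have 1: "((\<lambda>x. norm (u1 x)) \<longlongrightarrow> norm b) at_top"
    by (rule norm_tendsto_of_diff) (simp add: norm_mult)
  have "((\<lambda>x. a * (p2 x - ?e x) + b * m2 x) \<longlongrightarrow> a * 0 + b * 0) at_top"
    using p m unfolding jost_plus_def jost_minus_def by (intro tendsto_intros) auto
  then have "((\<lambda>x. u2 x - a * ?e x) \<longlongrightarrow> 0) at_top" by (simp add: eq algebra_simps)
  then have "((\<lambda>x. norm (u2 x)) \<longlongrightarrow> norm a) at_top"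
    by (rule norm_tendsto_of_diff) (simp add: norm_mult)
  with 1 that jost_plus_tendsto[OF u] u show thesis unfolding jost_plus_def by blast
qed

text \<open>The conserved |u|^2 is evaluated at both ends. This provides the lower bound on |a| in
  the quotient b/a.\<close>

lemma scattering_unitarity:
  assumes "ZS_solution A \<epsilon> lam u1 u2"
    "((\<lambda>x. norm (u1 x)) \<longlongrightarrow> 0) at_bot" "((\<lambda>x. norm (u2 x)) \<longlongrightarrow> 1) at_bot"
    "((\<lambda>x. norm (u1 x)) \<longlongrightarrow> \<beta>) at_top" "((\<lambda>x. norm (u2 x)) \<longlongrightarrow> \<alpha>) at_top"
  shows "\<alpha>\<^sup>2 + \<beta>\<^sup>2 = 1"
proof -
  define n where "n = (norm (u1 0))\<^sup>2 + (norm (u2 0))\<^sup>2"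
  have n: "(norm (u1 x))\<^sup>2 + (norm (u2 x))\<^sup>2 = n" for x
    unfolding n_def by (rule ZS_solution_norm[OF assms(1)])
  have "((\<lambda>x. (norm (u1 x))\<^sup>2 + (norm (u2 x))\<^sup>2) \<longlongrightarrow> 0\<^sup>2 + 1\<^sup>2) at_bot"
    by (intro tendsto_intros assms)
  then have "n = 1" unfolding n by (simp add: tendsto_const_iff)
  have "((\<lambda>x. (norm (u1 x))\<^sup>2 + (norm (u2 x))\<^sup>2) \<longlongrightarrow> \<beta>\<^sup>2 + \<alpha>\<^sup>2) at_top"
    by (intro tendsto_intros assms)
  then show ?thesis unfolding n using \<open>n = 1\<close> by (simp add: tendsto_const_iff add.commute)
qed

theorem theorem2p1:
  fixes A :: "real \<Rightarrow> real"
  assumes "assumption_A1 A"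
  shows "\<forall>\<delta> > 0. \<exists>\<sigma> > 0. \<exists>C \<epsilon>0. \<epsilon>0 > 0 \<and>
           (\<forall>\<epsilon> lam a b. 0 < \<epsilon> \<and> \<epsilon> < \<epsilon>0 \<and> \<bar>lam\<bar> \<ge> \<delta> \<and> scattering_ab A \<epsilon> lam a b \<longrightarrow>
              a \<noteq> 0 \<and> cmod (b / a) \<le> C * exp (- \<sigma> / \<epsilon>))"
proof (intro allI impI)
  fix \<delta> :: real assume \<delta>: "\<delta> > 0"
  obtain F r \<tau> C where "decaying_potential F A r \<tau> C"
    using assumption_A1_strip[OF assms] unfolding decaying_potential_def by metis
  then interpret decaying_potential F A r \<tau> C .
  obtain \<eta> K where \<eta>: "\<eta> > 0" and main:
    "\<And>\<epsilon> lam u1 u2 \<beta>. \<epsilon> > 0 \<Longrightarrow> \<bar>lam\<bar> \<ge> \<delta> \<Longrightarrow> ZS_solution A \<epsilon> lam u1 u2 \<Longrightarrow>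
      ((\<lambda>x. norm (u1 x)) \<longlongrightarrow> 0) at_bot \<Longrightarrow> ((\<lambda>x. norm (u2 x)) \<longlongrightarrow> 1) at_bot \<Longrightarrow>
      ((\<lambda>x. norm (u1 x)) \<longlongrightarrow> \<beta>) at_top \<Longrightarrow> \<beta> \<le> K * exp (- \<eta> / \<epsilon>)"
    using transition_amplitude_bound[OF \<delta>] by blast
  \<comment> \<open>Below this threshold 2 |K| <= \<eta>/\<epsilon> <= exp (\<eta>/\<epsilon>),
    hence |b| <= 1/2 and by unitarity |a| >= 1/2; dividing by \<open>a\<close> then costs at most a
    factor 2.\<close>
  define \<epsilon>0 where "\<epsilon>0 = \<eta> / (2 * \<bar>K\<bar> + 1)"
  have \<epsilon>0: "\<epsilon>0 > 0" using \<eta> by (simp add: \<epsilon>0_def)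
  have "a \<noteq> 0 \<and> cmod (b / a) \<le> 2 * K * exp (- \<eta> / \<epsilon>)"
    if \<epsilon>: "0 < \<epsilon>" "\<epsilon> < \<epsilon>0" and lam: "\<bar>lam\<bar> \<ge> \<delta>" and ab: "scattering_ab A \<epsilon> lam a b" for \<epsilon> lam a b
  proof -
    obtain u1 u2 where u: "ZS_solution A \<epsilon> lam u1 u2"
      "((\<lambda>x. norm (u1 x)) \<longlongrightarrow> 0) at_bot" "((\<lambda>x. norm (u2 x)) \<longlongrightarrow> 1) at_bot"
      "((\<lambda>x. norm (u1 x)) \<longlongrightarrow> norm b) at_top" "((\<lambda>x. norm (u2 x)) \<longlongrightarrow> norm a) at_top"
      using scattering_limits[OF ab] .
    have b: "norm b \<le> K * exp (- \<eta> / \<epsilon>)" using main[OF \<epsilon>(1) lam u(1-4)] .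
    have "2 * \<bar>K\<bar> + 1 \<le> \<eta> / \<epsilon>"
      using \<epsilon> by (simp add: \<epsilon>0_def field_simps)
    then have "2 * \<bar>K\<bar> \<le> exp (\<eta> / \<epsilon>)" using exp_ge_add_one_self[of "\<eta> / \<epsilon>"] by linarith
    then have "2 * \<bar>K\<bar> * exp (- \<eta> / \<epsilon>) \<le> exp (\<eta> / \<epsilon>) * exp (- \<eta> / \<epsilon>)"
      by (rule mult_right_mono) simp
    also have "\<dots> = 1" by (simp add: exp_add[symmetric])
    moreover have "K * exp (- \<eta> / \<epsilon>) \<le> \<bar>K\<bar> * exp (- \<eta> / \<epsilon>)" by (intro mult_right_mono) auto
    ultimately have "norm b \<le> 1/2" using b by linarith
    then have "(norm b)\<^sup>2 \<le> (1/2)\<^sup>2" by (intro power_mono) auto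
    then have "(1/2)\<^sup>2 \<le> (norm a)\<^sup>2"
      using scattering_unitarity[OF u] by (simp add: power2_eq_square)
    then have a: "norm a \<ge> 1/2" by (rule power2_le_imp_le) simp
    have "norm (b / a) \<le> (K * exp (- \<eta> / \<epsilon>)) / (1/2)"
      unfolding norm_divide using a b by (intro frac_le) (auto intro: order_trans[OF norm_ge_zero])
    then show ?thesis using a by auto
  qed
  then show "\<exists>\<sigma> > 0. \<exists>C \<epsilon>0. \<epsilon>0 > 0 \<and>
      (\<forall>\<epsilon> lam a b. 0 < \<epsilon> \<and> \<epsilon> < \<epsilon>0 \<and> \<bar>lam\<bar> \<ge> \<delta> \<and> scattering_ab A \<epsilon> lam a b \<longrightarrow>
        a \<noteq> 0 \<and> cmod (b / a) \<le> C * exp (- \<sigma> / \<epsilon>))"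
    using \<eta> \<epsilon>0 by blast
qed

end
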